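(* Let $G$ be a connected $\{C_{3},C_{4}\}$-free graph with minimum degree $\delta(G)\geq 3$, and let $\Delta(G)$ denote its maximum degree. Then the following hold. (i) If $\Delta(G)\geq 943218$, then $T_{8}^{(1)}\prec G$. (ii) If $\Delta(G)\geq 190375$, then $T_{8}^{(2)}\prec G$. (iii) If $\Delta(G)\geq 197433$, then $T_{9}\prec G$.
   Context: All graphs are finite, simple and undirected. $C_n$ is the cycle of order $n$. $H\prec G$ means that $G$ contains an induced subgraph isomorphic to $H$; a graph is $\{C_3,C_4\}$-free if it contains neither $C_3$ nor $C_4$ as an induced subgraph. For $n\geq 4$, $T_n$ is the graph obtained from a path $u_1u_2\cdots u_n$ of order $n$ by adding two vertices $v_3,v_3'$ and the edges $u_3v_3,\ v_3v_3'$. $T_8^{(1)}$ is the graph obtained from $T_8$ by adding two vertices $w_5,w_6$ and the edges $u_5w_5,\ u_6w_6$. $T_8^{(2)}$ is the graph obtained from $T_8$ by adding one vertex $w_4$ and the edge $u_4w_4$. *)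

theory Defs
  imports "Graph_Theory.Graph_Theory"
begin

text \<open>
  Finite simple undirected graphs are the symmetric digraphs of the locale \<^locale>\<open>graph\<close> (finite,
  loopfree, no parallel arcs): every edge is a pair of opposite arcs, so the degree of a vertex is
  its \<^const>\<open>out_degree\<close>.
\<close>

definition min_degree :: "('a, 'b) pre_digraph \<Rightarrow> nat" where
  "min_degree G = Min (out_degree G ` verts G)"

definition max_degree :: "('a, 'b) pre_digraph \<Rightarrow> nat" where
  "max_degree G = Max (out_degree G ` verts G)"

definition induced_in :: "('c, 'd) pre_digraph \<Rightarrow> ('a, 'b) pre_digraph \<Rightarrow> bool" where
  "induced_in H G \<longleftrightarrow> (\<exists>K. induced_subgraph K G \<and> digraph_iso H K)"

text \<open>In \<open>add_edges G S E\<close> each edge to be added is listed in \<open>E\<close> in one orientation only.\<close>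

definition add_edges ::
  "'a pair_pre_digraph \<Rightarrow> 'a set \<Rightarrow> ('a \<times> 'a) set \<Rightarrow> 'a pair_pre_digraph" where
  "add_edges G S E = \<lparr>pverts = pverts G \<union> S, parcs = parcs G \<union> E \<union> E\<inverse>\<rparr>"

text \<open>Only meaningful for \<open>n \<ge> 3\<close>.\<close>

definition cycle_graph :: "nat \<Rightarrow> nat pair_pre_digraph" where
  "cycle_graph n = add_edges \<lparr>pverts = {}, parcs = {}\<rparr> {..<n} {(i, (i + 1) mod n) | i. i < n}"

text \<open>\<open>Vu i\<close>, \<open>Vv i\<close>, \<open>Vv' i\<close>, \<open>Vw i\<close> stand for $u_i$, $v_i$, $v_i'$, $w_i$.\<close>

datatype tvert = Vu nat | Vv nat | Vv' nat | Vw nat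

definition path_u :: "nat \<Rightarrow> tvert pair_pre_digraph" where
  "path_u n = add_edges \<lparr>pverts = {}, parcs = {}\<rparr>
     (Vu ` {1..n}) {(Vu i, Vu (i + 1)) | i. 1 \<le> i \<and> i < n}"

definition T_graph :: "nat \<Rightarrow> tvert pair_pre_digraph" where
  "T_graph n = add_edges (path_u n) {Vv 3, Vv' 3} {(Vu 3, Vv 3), (Vv 3, Vv' 3)}"

definition T8_1 :: "tvert pair_pre_digraph" where
  "T8_1 = add_edges (T_graph 8) {Vw 5, Vw 6} {(Vu 5, Vw 5), (Vu 6, Vw 6)}"

definition T8_2 :: "tvert pair_pre_digraph" where
  "T8_2 = add_edges (T_graph 8) {Vw 4} {(Vu 4, Vw 4)}"

lemma pair_graph_add_edges:
  assumes "pair_graph G" "finite S" "finite E"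
    and "\<And>x y. (x, y) \<in> E \<Longrightarrow> x \<in> pverts G \<union> S \<and> y \<in> pverts G \<union> S \<and> x \<noteq> y"
  shows "pair_graph (add_edges G S E)"
proof -
  interpret pair_graph G by fact
  have "sym (parcs G)"
    using pair_sym_arcs by (simp add: symmetric_def)
  then have s: "sym (parcs G \<union> E \<union> E\<inverse>)"
    by (auto simp: sym_def)
  have E: "x \<in> pverts G \<union> S" "y \<in> pverts G \<union> S" "x \<noteq> y" if "(x, y) \<in> E" for x y
    using assms(4)[OF that] by auto
  show ?thesis
    using assms(2-3) s pair_finite_verts pair_finite_arcs
    by unfold_locales
      (auto simp: add_edges_def symmetric_def dest: in_arcsD1 in_arcsD2 pair_no_loops E)
qed

lemma pair_graph_empty: "pair_graph \<lparr>pverts = {}, parcs = {}\<rparr>"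
  by unfold_locales (auto simp: symmetric_def sym_def)

lemma pair_graph_cycle_graph:
  assumes "n \<ge> 3"
  shows "pair_graph (cycle_graph n)"
  unfolding cycle_graph_def
  using assms by (intro pair_graph_add_edges pair_graph_empty) (auto simp: mod_Suc)

lemma pair_graph_path_u: "pair_graph (path_u n)"
  unfolding path_u_def
  by (intro pair_graph_add_edges pair_graph_empty) auto

lemma pair_graph_T_graph:
  assumes "n \<ge> 4"
  shows "pair_graph (T_graph n)"
  unfolding T_graph_def
  using assms by (intro pair_graph_add_edges pair_graph_path_u) (auto simp: path_u_def add_edges_def)

lemma pair_graph_T8_1: "pair_graph T8_1"
  unfolding T8_1_def
  by (intro pair_graph_add_edges pair_graph_T_graph) (auto simp: T_graph_def path_u_def add_edges_def)

lemma pair_graph_T8_2: "pair_graph T8_2"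
  unfolding T8_2_def
  by (intro pair_graph_add_edges pair_graph_T_graph) (auto simp: T_graph_def path_u_def add_edges_def)

end

theory Submission
  imports Defs
begin

text \<open>
  Let \<open>x\<close> be a vertex of maximum degree. A graph without induced 3- and 4-cycles has girth at least
  five, so the neighbours \<open>y\<close> of \<open>x\<close> are independent, each has at least two children (neighbours other
  than \<open>x\<close>), and children of different \<open>y\<close> are different. In each of the three target trees, all pairs
  of vertices at distance two or three are automatically non-adjacent when the tree is laid out in a
  graph of girth five, so only pairs at distance at least four need attention.

  \<^bold>\<open>Two legs for free.\<close> Suppose that \<open>P \<union> {x}\<close> induces the target tree without the two legs of length
  two at its centre \<open>x = u\<^sub>3\<close>. Two legs \<open>x, y, b\<close> can be added unless for almost every \<open>y\<close> all children
  are adjacent to \<open>P\<close>. If no vertex of \<open>P\<close> is adjacent to many children, this is impossible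
  (\<open>two_legs_of_light\<close>). It is also impossible for both of two such sets \<open>P\<close> and \<open>Q\<close> that have at most
  one vertex \<open>q\<close> outside the neighbourhood of \<open>x\<close> in common: a child adjacent to both is adjacent to
  \<open>q\<close> or is one of the boundedly many common neighbours of different vertices of \<open>P\<close> and \<open>Q\<close>, and \<open>q\<close> is
  adjacent to at most one child of each \<open>y\<close> (\<open>two_legs_of_two\<close>).

  \<^bold>\<open>Hubs.\<close> Call a vertex \<open>p\<close> off the closed neighbourhood of \<open>x\<close> a hub of level 2, 3 or 4 if it is joined
  to many \<open>y\<close> by paths \<open>y, z, p\<close>, or \<open>y, z, w, p\<close>, or \<open>y, z, w, t, p\<close> that avoid \<open>x\<close>. Walking
  from \<open>x\<close> into a hub along one path and out of it along another yields the part of the target that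
  starts at \<open>x\<close>. At a hub of level 2 this can be done twice with only the hub in common. If there are no
  hubs of level 2, every such vertex is adjacent to few children, and doing it once suffices at level 3 or 4.
  In one configuration the walk out of a hub of level 2 always meets a second vertex \<open>q\<close>; then the
  tail is led through \<open>q\<close> instead. Hence large hubs give the target (lemmas \<open>embeds_*_of_hub*\<close>).

  \<^bold>\<open>No hubs.\<close> Choose below every \<open>y\<close> a subgraph of bounded size (a branch). Without hubs a branch is adjacent to few
  of the others, so two branches are anticomplete to each other, and the target appears with \<open>x\<close> as an
  interior vertex (\<open>u\<^sub>4\<close> or \<open>u\<^sub>5\<close>), one part in each branch (lemmas \<open>embeds_*_of_light\<close>).
\<close>

section \<open>Graphs of girth at least five\<close>

text \<open>
  A finite simple graph with vertex set \<open>V\<close> and edge relation \<open>E\<close>, with girth at least five and minimum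
  degree at least three.
\<close>

locale girth5_graph =
  fixes V :: "'a set" and E :: "'a \<Rightarrow> 'a \<Rightarrow> bool"
  assumes finite_V: "finite V"
    and edge_in_V: "E a b \<Longrightarrow> a \<in> V"
    and edge_sym: "E a b \<Longrightarrow> E b a"
    and edge_irrefl: "\<not> E a a"
    and no_triangle: "E a b \<Longrightarrow> E b c \<Longrightarrow> \<not> E a c"
    and no_C4: "E a b \<Longrightarrow> E b c \<Longrightarrow> E c d \<Longrightarrow> E d a \<Longrightarrow> a = c \<or> b = d"
    and degree_ge_3: "a \<in> V \<Longrightarrow> card {b. E a b} \<ge> 3"
begin

lemma edge_in_V2: "E a b \<Longrightarrow> b \<in> V"
  using edge_sym edge_in_V by blast

lemma finite_edge [simp]: "finite {b. E a b}"
  by (rule finite_subset[OF _ finite_V]) (auto dest: edge_in_V2)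

lemma edge_commute: "E a b \<longleftrightarrow> E b a"
  using edge_sym by blast

lemma edge_neq: "E a b \<Longrightarrow> a \<noteq> b"
  using edge_irrefl by blast

lemma not_edge_sym: "\<not> E a b \<Longrightarrow> \<not> E b a"
  using edge_sym by blast

lemma common_nbr_unique: "E a b \<Longrightarrow> E a d \<Longrightarrow> E c b \<Longrightarrow> E c d \<Longrightarrow> a \<noteq> c \<Longrightarrow> b = d"
  using no_C4[of a b c d] edge_sym by blast

lemma path3_not_edge: "E a b \<Longrightarrow> E b c \<Longrightarrow> E c d \<Longrightarrow> a \<noteq> c \<Longrightarrow> b \<noteq> d \<Longrightarrow> \<not> E a d"
  using no_C4[of a b c d] edge_sym by blast

lemma neq_of_nbr: "E a b \<Longrightarrow> \<not> E b c \<Longrightarrow> a \<noteq> c"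
  using edge_sym by blast

lemma third_nbr:
  assumes "a \<in> V"
  obtains b where "E a b" "b \<noteq> p" "b \<noteq> q"
proof -
  have "card {p, q} \<le> 2"
    by (cases "p = q") auto
  then have "\<not> {b. E a b} \<subseteq> {p, q}"
    using card_mono[of "{p, q}" "{b. E a b}"] degree_ge_3[OF assms] by auto
  then show thesis
    using that by auto
qed

text \<open>\<open>embeds H\<close>: the graph with edge relation \<open>E\<close> has an induced subgraph isomorphic to \<open>H\<close>.\<close>

definition embeds :: "'c pair_pre_digraph \<Rightarrow> bool" where
  "embeds H \<longleftrightarrow> (\<exists>f. inj_on f (pverts H) \<and> f ` pverts H \<subseteq> V
     \<and> (\<forall>a\<in>pverts H. \<forall>b\<in>pverts H. E (f a) (f b) \<longleftrightarrow> (a, b) \<in> parcs H))"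

text \<open>
  The embedding is given as a list of pairs of a vertex of \<open>H\<close> and its image; by symmetry each unordered
  pair of list entries is examined once.
\<close>

lemma embedsI:
  assumes H: "pair_graph H" and verts: "pverts H = fst ` set ps"
    and dist: "distinct (map fst ps)" and V: "snd ` set ps \<subseteq> V"
    and ps: "sorted_wrt (\<lambda>p q. snd p \<noteq> snd q \<and> (E (snd p) (snd q) \<longleftrightarrow> (fst p, fst q) \<in> parcs H)) ps"
  shows "embeds H"
proof -
  interpret pair_graph H by fact
  have arc_sym: "(b, a) \<in> parcs H" if "(a, b) \<in> parcs H" for a b
    using pair_sym_arcs that by (auto simp: symmetric_def sym_def)
  have no_loop: "(a, a) \<notin> parcs H" for a
    using pair_no_loops by fastforce
  define f where "f a = the (map_of ps a)" for a
  have f: "f a = u" if "(a, u) \<in> set ps" for a u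
    using that dist by (simp add: f_def)
  have pair: "(a = b \<longleftrightarrow> u = v) \<and> (E u v \<longleftrightarrow> (a, b) \<in> parcs H)"
    if ab: "(a, u) \<in> set ps" "(b, v) \<in> set ps" for a b u v
  proof -
    obtain i j where i: "i < length ps" "ps ! i = (a, u)" and j: "j < length ps" "ps ! j = (b, v)"
      using ab by (meson in_set_conv_nth)
    consider "i = j" | "i < j" | "j < i" by linarith
    then show ?thesis
    proof cases
      case 1
      then show ?thesis using i j edge_irrefl no_loop by auto
    next
      case 2
      then have "a \<noteq> b"
        using dist i j by (metis distinct_conv_nth fst_conv length_map nat_neq_iff nth_map)
      then show ?thesis
        using sorted_wrt_nth_less[OF ps 2 j(1)] i j by auto
    next
      case 3
      then have "a \<noteq> b"
        using dist i j by (metis distinct_conv_nth fst_conv length_map nat_neq_iff nth_map)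
      then show ?thesis
        using sorted_wrt_nth_less[OF ps 3 i(1)] i j edge_commute arc_sym by auto
    qed
  qed
  have ex: "\<exists>u. (a, u) \<in> set ps \<and> f a = u" if "a \<in> pverts H" for a
    using that f unfolding verts by force
  show ?thesis
    unfolding embeds_def
  proof (intro exI conjI ballI)
    show "inj_on f (pverts H)"
      by (rule inj_onI) (metis ex pair)
    show "f ` pverts H \<subseteq> V"
      using ex V by force
    show "E (f a) (f b) \<longleftrightarrow> (a, b) \<in> parcs H" if "a \<in> pverts H" "b \<in> pverts H" for a b
      using ex[OF that(1)] ex[OF that(2)] pair by blast
  qed
qed

end

section \<open>Recognising the three trees\<close>

lemma pverts_T_graph_9: "pverts (T_graph 9) =
    {Vu 1, Vu 2, Vu 3, Vu 4, Vu 5, Vu 6, Vu 7, Vu 8, Vu 9, Vv 3, Vv' 3}"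
proof -
  have "{1..9::nat} = {1, 2, 3, 4, 5, 6, 7, 8, 9}" by auto
  then show ?thesis by (auto simp: T_graph_def path_u_def add_edges_def)
qed

lemma pverts_T_graph_8: "pverts (T_graph 8) =
    {Vu 1, Vu 2, Vu 3, Vu 4, Vu 5, Vu 6, Vu 7, Vu 8, Vv 3, Vv' 3}"
proof -
  have "{1..8::nat} = {1, 2, 3, 4, 5, 6, 7, 8}" by auto
  then show ?thesis by (auto simp: T_graph_def path_u_def add_edges_def)
qed

lemma pverts_T8_2: "pverts T8_2 = insert (Vw 4) (pverts (T_graph 8))"
  by (simp add: T8_2_def add_edges_def)

lemma pverts_T8_1: "pverts T8_1 = insert (Vw 5) (insert (Vw 6) (pverts (T_graph 8)))"
  by (auto simp: T8_1_def add_edges_def)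

context girth5_graph
begin

text \<open>
  In the next three lemmas \<open>e\<close> lists the edges of the tree, \<open>n\<close> the pairs at distance two and \<open>d\<close> the
  pairs at distance at least four. Girth five takes care of the rest: pairs at distance two or three are
  non-adjacent, and images of vertices at distance at least three differ because one of them is adjacent
  to a vertex to which the other is not.
\<close>

lemma embeds_T9I:
  assumes e: "E u1 u2" "E u2 u3" "E u3 u4" "E u4 u5" "E u5 u6" "E u6 u7" "E u7 u8" "E u8 u9" "E u3 v"
      "E v v'"
    and n: "u1 \<noteq> u3" "u2 \<noteq> u4" "u2 \<noteq> v" "u3 \<noteq> u5" "u3 \<noteq> v'"
      "u4 \<noteq> u6" "u4 \<noteq> v" "u5 \<noteq> u7" "u6 \<noteq> u8" "u7 \<noteq> u9"
    and d: "\<not> E u1 u5" "\<not> E u1 u6" "\<not> E u1 u7" "\<not> E u1 u8" "\<not> E u1 u9"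
      "\<not> E u1 v'" "\<not> E u2 u6" "\<not> E u2 u7" "\<not> E u2 u8" "\<not> E u2 u9"
      "\<not> E u3 u7" "\<not> E u3 u8" "\<not> E u3 u9" "\<not> E u4 u8" "\<not> E u4 u9"
      "\<not> E u5 u9" "\<not> E u5 v'" "\<not> E u6 v" "\<not> E u6 v'" "\<not> E u7 v"
      "\<not> E u7 v'" "\<not> E u8 v" "\<not> E u8 v'" "\<not> E u9 v" "\<not> E u9 v'"
  shows "embeds (T_graph 9)"
proof -
  note es = e e[THEN edge_sym]
  have d2: "\<not> E u1 u3" "\<not> E u2 u4" "\<not> E u2 v" "\<not> E u3 u5" "\<not> E u3 v'"
    "\<not> E u4 u6" "\<not> E u4 v" "\<not> E u5 u7" "\<not> E u6 u8" "\<not> E u7 u9"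
    by (rule no_triangle, rule es, rule es)+
  have d3: "\<not> E u1 u4" "\<not> E u1 v" "\<not> E u2 u5" "\<not> E u2 v'" "\<not> E u3 u6"
    "\<not> E u4 u7" "\<not> E u4 v'" "\<not> E u5 u8" "\<not> E u5 v" "\<not> E u6 u9"
    by (rule path3_not_edge, rule es, rule es, rule es, (rule n n[symmetric])+)+
  note ds = d d2 d3 d[THEN not_edge_sym] d2[THEN not_edge_sym] d3[THEN not_edge_sym]
  have ne: "u1 \<noteq> u4" "u1 \<noteq> u5" "u1 \<noteq> u6" "u1 \<noteq> u7" "u1 \<noteq> u8"
    "u1 \<noteq> u9" "u1 \<noteq> v" "u1 \<noteq> v'" "u2 \<noteq> u5" "u2 \<noteq> u6"
    "u2 \<noteq> u7" "u2 \<noteq> u8" "u2 \<noteq> u9" "u2 \<noteq> v'" "u3 \<noteq> u6"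
    "u3 \<noteq> u7" "u3 \<noteq> u8" "u3 \<noteq> u9" "u4 \<noteq> u7" "u4 \<noteq> u8"
    "u4 \<noteq> u9" "u4 \<noteq> v'" "u5 \<noteq> u8" "u5 \<noteq> u9" "u5 \<noteq> v"
    "u5 \<noteq> v'" "u6 \<noteq> u9" "u6 \<noteq> v" "u6 \<noteq> v'" "u7 \<noteq> v"
    "u7 \<noteq> v'" "u8 \<noteq> v" "u8 \<noteq> v'" "u9 \<noteq> v" "u9 \<noteq> v'"
    by (rule neq_of_nbr, rule es, rule ds)+
  show ?thesis
    by (rule embedsI[OF pair_graph_T_graph, where ps =
        "[(Vu 1, u1), (Vu 2, u2), (Vu 3, u3), (Vu 4, u4), (Vu 5, u5), (Vu 6, u6), (Vu 7, u7),
        (Vu 8, u8), (Vu 9, u9), (Vv 3, v), (Vv' 3, v')]"])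
      (auto simp: pverts_T_graph_9 es ds n ne edge_neq e[THEN edge_in_V] e[THEN edge_in_V2]
        T_graph_def path_u_def add_edges_def)
qed

lemma embeds_T8_2I:
  assumes e: "E u1 u2" "E u2 u3" "E u3 u4" "E u4 u5" "E u5 u6" "E u6 u7" "E u7 u8" "E u3 v" "E v v'"
      "E u4 w"
    and n: "u1 \<noteq> u3" "u2 \<noteq> u4" "u2 \<noteq> v" "u3 \<noteq> u5" "u3 \<noteq> v'"
      "u3 \<noteq> w" "u4 \<noteq> u6" "u4 \<noteq> v" "u5 \<noteq> u7" "u5 \<noteq> w"
      "u6 \<noteq> u8"
    and d: "\<not> E u1 u5" "\<not> E u1 u6" "\<not> E u1 u7" "\<not> E u1 u8" "\<not> E u1 v'"
      "\<not> E u1 w" "\<not> E u2 u6" "\<not> E u2 u7" "\<not> E u2 u8" "\<not> E u3 u7"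
      "\<not> E u3 u8" "\<not> E u4 u8" "\<not> E u5 v'" "\<not> E u6 v" "\<not> E u6 v'"
      "\<not> E u7 v" "\<not> E u7 v'" "\<not> E u7 w" "\<not> E u8 v" "\<not> E u8 v'"
      "\<not> E u8 w" "\<not> E v' w"
  shows "embeds T8_2"
proof -
  note es = e e[THEN edge_sym]
  have d2: "\<not> E u1 u3" "\<not> E u2 u4" "\<not> E u2 v" "\<not> E u3 u5" "\<not> E u3 v'"
    "\<not> E u3 w" "\<not> E u4 u6" "\<not> E u4 v" "\<not> E u5 u7" "\<not> E u5 w"
    "\<not> E u6 u8"
    by (rule no_triangle, rule es, rule es)+
  have d3: "\<not> E u1 u4" "\<not> E u1 v" "\<not> E u2 u5" "\<not> E u2 v'" "\<not> E u2 w"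
    "\<not> E u3 u6" "\<not> E u4 u7" "\<not> E u4 v'" "\<not> E u5 u8" "\<not> E u5 v"
    "\<not> E u6 w" "\<not> E v w"
    by (rule path3_not_edge, rule es, rule es, rule es, (rule n n[symmetric])+)+
  note ds = d d2 d3 d[THEN not_edge_sym] d2[THEN not_edge_sym] d3[THEN not_edge_sym]
  have ne: "u1 \<noteq> u4" "u1 \<noteq> u5" "u1 \<noteq> u6" "u1 \<noteq> u7" "u1 \<noteq> u8"
    "u1 \<noteq> v" "u1 \<noteq> v'" "u1 \<noteq> w" "u2 \<noteq> u5" "u2 \<noteq> u6"
    "u2 \<noteq> u7" "u2 \<noteq> u8" "u2 \<noteq> v'" "u2 \<noteq> w" "u3 \<noteq> u6"
    "u3 \<noteq> u7" "u3 \<noteq> u8" "u4 \<noteq> u7" "u4 \<noteq> u8" "u4 \<noteq> v'"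
    "u5 \<noteq> u8" "u5 \<noteq> v" "u5 \<noteq> v'" "u6 \<noteq> v" "u6 \<noteq> v'"
    "u6 \<noteq> w" "u7 \<noteq> v" "u7 \<noteq> v'" "u7 \<noteq> w" "u8 \<noteq> v"
    "u8 \<noteq> v'" "u8 \<noteq> w" "v \<noteq> w" "v' \<noteq> w"
    by (rule neq_of_nbr, rule es, rule ds)+
  show ?thesis
    by (rule embedsI[OF pair_graph_T8_2, where ps =
        "[(Vu 1, u1), (Vu 2, u2), (Vu 3, u3), (Vu 4, u4), (Vu 5, u5), (Vu 6, u6), (Vu 7, u7),
        (Vu 8, u8), (Vv 3, v), (Vv' 3, v'), (Vw 4, w)]"])
      (auto simp: pverts_T8_2 pverts_T_graph_8 es ds n ne edge_neq e[THEN edge_in_V] e[THEN edge_in_V2]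
        T8_2_def T_graph_def path_u_def add_edges_def)
qed

lemma embeds_T8_1I:
  assumes e: "E u1 u2" "E u2 u3" "E u3 u4" "E u4 u5" "E u5 u6" "E u6 u7" "E u7 u8" "E u3 v" "E v v'"
      "E u5 a" "E u6 b"
    and n: "u1 \<noteq> u3" "u2 \<noteq> u4" "u2 \<noteq> v" "u3 \<noteq> u5" "u3 \<noteq> v'"
      "u4 \<noteq> u6" "u4 \<noteq> v" "u4 \<noteq> a" "u5 \<noteq> u7" "u5 \<noteq> b"
      "u6 \<noteq> u8" "u6 \<noteq> a" "u7 \<noteq> b"
    and d: "\<not> E u1 u5" "\<not> E u1 u6" "\<not> E u1 u7" "\<not> E u1 u8" "\<not> E u1 v'"
      "\<not> E u1 a" "\<not> E u1 b" "\<not> E u2 u6" "\<not> E u2 u7" "\<not> E u2 u8"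
      "\<not> E u2 a" "\<not> E u2 b" "\<not> E u3 u7" "\<not> E u3 u8" "\<not> E u3 b"
      "\<not> E u4 u8" "\<not> E u5 v'" "\<not> E u6 v" "\<not> E u6 v'" "\<not> E u7 v"
      "\<not> E u7 v'" "\<not> E u8 v" "\<not> E u8 v'" "\<not> E u8 a" "\<not> E v a"
      "\<not> E v b" "\<not> E v' a" "\<not> E v' b"
  shows "embeds T8_1"
proof -
  note es = e e[THEN edge_sym]
  have d2: "\<not> E u1 u3" "\<not> E u2 u4" "\<not> E u2 v" "\<not> E u3 u5" "\<not> E u3 v'"
    "\<not> E u4 u6" "\<not> E u4 v" "\<not> E u4 a" "\<not> E u5 u7" "\<not> E u5 b"
    "\<not> E u6 u8" "\<not> E u6 a" "\<not> E u7 b"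
    by (rule no_triangle, rule es, rule es)+
  have d3: "\<not> E u1 u4" "\<not> E u1 v" "\<not> E u2 u5" "\<not> E u2 v'" "\<not> E u3 u6"
    "\<not> E u3 a" "\<not> E u4 u7" "\<not> E u4 v'" "\<not> E u4 b" "\<not> E u5 u8"
    "\<not> E u5 v" "\<not> E u7 a" "\<not> E u8 b" "\<not> E a b"
    by (rule path3_not_edge, rule es, rule es, rule es, (rule n n[symmetric])+)+
  note ds = d d2 d3 d[THEN not_edge_sym] d2[THEN not_edge_sym] d3[THEN not_edge_sym]
  have ne: "u1 \<noteq> u4" "u1 \<noteq> u5" "u1 \<noteq> u6" "u1 \<noteq> u7" "u1 \<noteq> u8"
    "u1 \<noteq> v" "u1 \<noteq> v'" "u1 \<noteq> a" "u1 \<noteq> b" "u2 \<noteq> u5"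
    "u2 \<noteq> u6" "u2 \<noteq> u7" "u2 \<noteq> u8" "u2 \<noteq> v'" "u2 \<noteq> a"
    "u2 \<noteq> b" "u3 \<noteq> u6" "u3 \<noteq> u7" "u3 \<noteq> u8" "u3 \<noteq> a"
    "u3 \<noteq> b" "u4 \<noteq> u7" "u4 \<noteq> u8" "u4 \<noteq> v'" "u4 \<noteq> b"
    "u5 \<noteq> u8" "u5 \<noteq> v" "u5 \<noteq> v'" "u6 \<noteq> v" "u6 \<noteq> v'"
    "u7 \<noteq> v" "u7 \<noteq> v'" "u7 \<noteq> a" "u8 \<noteq> v" "u8 \<noteq> v'"
    "u8 \<noteq> a" "u8 \<noteq> b" "v \<noteq> a" "v \<noteq> b" "v' \<noteq> a" "v' \<noteq> b"
    "a \<noteq> b"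
    by (rule neq_of_nbr, rule es, rule ds)+
  show ?thesis
    by (rule embedsI[OF pair_graph_T8_1, where ps =
        "[(Vu 1, u1), (Vu 2, u2), (Vu 3, u3), (Vu 4, u4), (Vu 5, u5), (Vu 6, u6), (Vu 7, u7),
        (Vu 8, u8), (Vv 3, v), (Vv' 3, v'), (Vw 5, a), (Vw 6, b)]"])
      (auto simp: pverts_T8_1 pverts_T_graph_8 es ds n ne edge_neq e[THEN edge_in_V] e[THEN edge_in_V2]
        T8_1_def T_graph_def path_u_def add_edges_def)
qed

end

section \<open>Selecting non-conflicting elements\<close>

text \<open>A digraph of maximum out-degree \<open>k\<close> on at least \<open>m (2k + 1)\<close> vertices has an independent \<open>m\<close>-set.\<close>

lemma independent_subset:
  fixes R :: "'b \<Rightarrow> 'b \<Rightarrow> bool"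
  assumes "finite A" "\<And>a. a \<in> A \<Longrightarrow> card {b\<in>A. R a b} \<le> k" "card A \<ge> m * (2 * k + 1)"
  shows "\<exists>B\<subseteq>A. card B = m \<and> (\<forall>a\<in>B. \<forall>b\<in>B. a \<noteq> b \<longrightarrow> \<not> R a b)"
  using assms
proof (induction m arbitrary: A)
  case 0
  then show ?case by (intro exI[of _ "{}"]) auto
next
  case (Suc m)
  note fin = \<open>finite A\<close> and out = Suc.prems(2)
  \<comment> \<open>The in-degrees sum to at most \<open>k * card A\<close>, so some in-degree is at most \<open>k\<close>.\<close>
  have "\<exists>a\<in>A. card {b\<in>A. R b a} \<le> k"
  proof (rule ccontr)
    assume "\<not> ?thesis"
    then have "\<And>a. a \<in> A \<Longrightarrow> Suc k \<le> card {b\<in>A. R b a}" by (auto simp: not_le)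
    then have "card A * Suc k \<le> (\<Sum>a\<in>A. card {b\<in>A. R b a})"
      using sum_bounded_below[of A "Suc k" "\<lambda>a. card {b\<in>A. R b a}"] by simp
    also have "\<dots> = (\<Sum>b\<in>A. card {a\<in>A. R b a})"
      using sum_multicount_gen[of A A R "\<lambda>a. card {b\<in>A. R b a}"] fin by simp
    also have "\<dots> \<le> card A * k"
      using sum_bounded_above[of A "\<lambda>b. card {a\<in>A. R b a}" k] out by simp
    finally have "card A = 0" by simp
    with Suc.prems(3) show False by simp
  qed
  then obtain a where a: "a \<in> A" "card {b\<in>A. R b a} \<le> k" by blast
  define D where "D = {b\<in>A. R b a} \<union> {b\<in>A. R a b} \<union> {a}"
  have "card D \<le> card {b\<in>A. R b a} + card {b\<in>A. R a b} + card {a}"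
    unfolding D_def by (meson add_mono_thms_linordered_semiring(3) card_Un_le le_trans)
  then have D: "card D \<le> 2 * k + 1" "D \<subseteq> A"
    using a out[of a] by (auto simp: D_def)
  then have "card (A - D) \<ge> m * (2 * k + 1)"
    using Suc.prems(3) fin by (simp add: card_Diff_subset finite_subset)
  moreover have "card {c \<in> A - D. R b c} \<le> k" if "b \<in> A - D" for b
    using that fin by (intro order_trans[OF card_mono out[of b]]) auto
  ultimately obtain B where B: "B \<subseteq> A - D" "card B = m" "\<forall>a\<in>B. \<forall>b\<in>B. a \<noteq> b \<longrightarrow> \<not> R a b"
    using Suc.IH[of "A - D"] fin by auto
  have "finite B" "a \<notin> B"
    using B(1) fin by (auto simp: D_def intro: finite_subset)
  then show ?case
    using B a by (intro exI[of _ "insert a B"]) (auto simp: D_def)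
qed

lemma inj_on_subset_of_small_fibres:
  fixes f :: "'b \<Rightarrow> 'c"
  assumes fin: "finite I" and fibre: "\<And>v. card {i\<in>I. f i = v} \<le> h" and card: "card I > r * h"
  obtains J where "J \<subseteq> I" "inj_on f J" "card J > r"
proof -
  obtain J where J: "J \<subseteq> I" "inj_on f J" "f ` J = f ` I"
    by (metis subset_image_inj subset_refl)
  have "I = (\<Union>v\<in>f ` I. {i\<in>I. f i = v})" by auto
  then have "card I \<le> (\<Sum>v\<in>f ` I. card {i\<in>I. f i = v})"
    using card_UN_le[of "f ` I" "\<lambda>v. {i\<in>I. f i = v}"] fin by simp
  also have "\<dots> \<le> card (f ` I) * h"
    using sum_bounded_above[of "f ` I" _ h] fibre by fastforce
  also have "card (f ` I) = card J"
    using J by (metis card_image)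
  finally have "card I \<le> card J * h" .
  then have "r < card J"
    using card by (meson leI le_trans mult_le_mono1 not_le)
  then show thesis using that J by blast
qed

lemma card_Union_le_mult:
  assumes "finite P" "\<And>p. p \<in> P \<Longrightarrow> card (f p) \<le> h"
  shows "card (\<Union>p\<in>P. f p) \<le> card P * h"
  using card_UN_le[OF assms(1), of f] sum_bounded_above[of P "\<lambda>p. card (f p)" h] assms(2)
  by fastforce

lemma card_le_1I: "finite S \<Longrightarrow> (\<And>a b. a \<in> S \<Longrightarrow> b \<in> S \<Longrightarrow> a = b) \<Longrightarrow> card S \<le> 1"
  using card_le_Suc0_iff_eq[of S] by auto

lemma card_gt_2_obtain:
  assumes "card S > 2"
  obtains a b c where "a \<in> S" "b \<in> S" "c \<in> S" "a \<noteq> b" "a \<noteq> c" "b \<noteq> c"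
proof -
  obtain T where "T \<subseteq> S" "card T = 3"
    using obtain_subset_with_card_n[of 3 S] assms by auto
  then show thesis
    using that unfolding card_3_iff by auto
qed

lemma card_distinct_list:
  assumes "card S = n" "n > 0"
  obtains xs where "distinct xs" "set xs = S" "length xs = n"
proof -
  have "finite S"
    using assms by (auto intro: card_ge_0_finite)
  then show thesis
    using finite_distinct_list[of S] that assms distinct_card by metis
qed

lemma independent_pair:
  fixes R :: "'b \<Rightarrow> 'b \<Rightarrow> bool"
  assumes "finite A" "\<And>a. a \<in> A \<Longrightarrow> card {b\<in>A. R a b} \<le> k" "card A \<ge> 2 * (2 * k + 1)"
  obtains a b where "a \<in> A" "b \<in> A" "a \<noteq> b" "\<not> R a b" "\<not> R b a"
proof -
  obtain B where B: "B \<subseteq> A" "card B = 2" "\<forall>a\<in>B. \<forall>b\<in>B. a \<noteq> b \<longrightarrow> \<not> R a b"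
    using independent_subset[of A R k 2] assms by auto
  obtain a b where "B = {a, b}" "a \<noteq> b"
    using B(2) unfolding card_2_iff by auto
  then show thesis
    using B by (intro that[of a b]) auto
qed

lemma card_Collect_disj_le:
  assumes "card {j\<in>A. P j} \<le> m" "card {j\<in>A. Q j} \<le> n"
  shows "card {j\<in>A. P j \<or> Q j} \<le> m + n"
proof -
  have "{j\<in>A. P j \<or> Q j} = {j\<in>A. P j} \<union> {j\<in>A. Q j}" by auto
  then show ?thesis
    using card_Un_le[of "{j\<in>A. P j}" "{j\<in>A. Q j}"] assms by simp
qed

lemma card_le_7: "card {a, b, c, d, e, f} \<le> 7" "card {a, b, c, d, e, f, g} \<le> 7"
  using card_length[of "[a, b, c, d, e, f]"] card_length[of "[a, b, c, d, e, f, g]"] by auto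

lemma card_remove_ge:
  assumes "finite J" "card {y\<in>J. P y} \<le> m" "card J \<ge> n + m"
  shows "card {y\<in>J. \<not> P y} \<ge> n"
proof -
  have "{y\<in>J. \<not> P y} = J - {y\<in>J. P y}" by auto
  then have "card {y\<in>J. \<not> P y} = card J - card {y\<in>J. P y}"
    using assms(1) by (simp add: card_Diff_subset)
  then show ?thesis using assms by simp
qed

section \<open>The surroundings of a root\<close>

locale rooted_girth5_graph = girth5_graph +
  fixes x :: 'a
begin

text \<open>A vertex is \<open>far\<close> if its distance from \<open>x\<close> is at least two.\<close>

definition far :: "'a \<Rightarrow> bool" where
  "far v \<longleftrightarrow> v \<noteq> x \<and> \<not> E x v"

lemma farD: "far v \<Longrightarrow> v \<noteq> x" "far v \<Longrightarrow> x \<noteq> v" "far v \<Longrightarrow> \<not> E x v" "far v \<Longrightarrow> \<not> E v x"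
  by (auto simp: far_def dest: edge_sym)

lemma child_far: "E x y \<Longrightarrow> E y z \<Longrightarrow> z \<noteq> x \<Longrightarrow> far z"
  using no_triangle by (auto simp: far_def)

lemma parent_unique: "E x y \<Longrightarrow> E x y' \<Longrightarrow> E v y \<Longrightarrow> E v y' \<Longrightarrow> v \<noteq> x \<Longrightarrow> y = y'"
  using common_nbr_unique[of v y y' x] by blast

lemma grandchild_far: "E x y \<Longrightarrow> E y z \<Longrightarrow> z \<noteq> x \<Longrightarrow> E z w \<Longrightarrow> w \<noteq> y \<Longrightarrow> far w"
  by (metis child_far edge_sym far_def parent_unique)

lemma child_exists:
  assumes "E x y"
  obtains z where "E y z" "z \<noteq> x" "z \<noteq> p"
  using third_nbr[of y x p] assms edge_in_V2 by blast

lemma far_nbr_exists: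
  assumes "far w" "w \<in> V"
  obtains t where "E w t" "t \<noteq> z" "far t"
proof (cases "\<exists>q. E x q \<and> E w q")
  case True
  then obtain q where "E x q" "E w q" by blast
  then show thesis
    using third_nbr[of w z q] that assms by (metis edge_sym far_def parent_unique)
next
  case False
  then show thesis
    using third_nbr[of w z z] that assms by (metis edge_sym far_def)
qed

lemma card_parents_le: "v \<noteq> x \<Longrightarrow> card {y\<in>S. E x y \<and> E v y} \<le> 1"
  by (rule card_le_1I) (auto intro: parent_unique rev_finite_subset[OF finite_edge[of x]])

text \<open>\<open>nb k p\<close>\<close>

text \<open>
  \<open>hub3 p y z w\<close> and \<open>hub4 p y z w t\<close> say that \<open>p\<close> is joined to the neighbour \<open>y\<close> of \<open>x\<close> by the path
  \<open>y, z, w, p\<close> or \<open>y, z, w, t, p\<close> that does not pass through \<open>x\<close>. That \<open>w\<close> is far from \<open>x\<close> is automatic,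
  for \<open>t\<close> it is required. The sets \<open>nb2 p\<close>, \<open>nb3 p\<close>, \<open>nb4 p\<close> consist of the \<open>y\<close> that are joined to \<open>p\<close> by
  a path of length two, three or four of this kind; \<open>p\<close> is a hub of level \<open>k\<close> if the corresponding set is large.
\<close>

definition hub3 :: "'a \<Rightarrow> 'a \<Rightarrow> 'a \<Rightarrow> 'a \<Rightarrow> bool" where
  "hub3 p y z w \<longleftrightarrow> E x y \<and> E y z \<and> z \<noteq> x \<and> E z w \<and> w \<noteq> y \<and> E p w \<and> p \<noteq> z"

definition hub4 :: "'a \<Rightarrow> 'a \<Rightarrow> 'a \<Rightarrow> 'a \<Rightarrow> 'a \<Rightarrow> bool" where
  "hub4 p y z w t \<longleftrightarrow> E x y \<and> E y z \<and> z \<noteq> x \<and> E z w \<and> w \<noteq> y \<and> E w t \<and> t \<noteq> z \<and> far t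
     \<and> E p t \<and> p \<noteq> w"

definition nb2 :: "'a \<Rightarrow> 'a set" where
  "nb2 p = {y. \<exists>z. E x y \<and> E y z \<and> z \<noteq> x \<and> E p z}"

definition nb3 :: "'a \<Rightarrow> 'a set" where
  "nb3 p = {y. \<exists>z w. hub3 p y z w}"

definition nb4 :: "'a \<Rightarrow> 'a set" where
  "nb4 p = {y. \<exists>z w t. hub4 p y z w t}"

lemma finite_nb [simp]: "finite (nb2 p)" "finite (nb3 p)" "finite (nb4 p)"
  by (rule finite_subset[OF _ finite_edge[of x]]; auto simp: nb2_def nb3_def nb4_def hub3_def hub4_def)+

section \<open>Adding two legs of length two at the root\<close>

text \<open>\<open>free P y b\<close>: the leg \<open>x, y, b\<close> is disjoint from \<open>P\<close> and not adjacent to it, except through \<open>x\<close>.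
  That \<open>b\<close> is not in \<open>P\<close> follows from \<open>E y b\<close>.\<close>

definition free :: "'a set \<Rightarrow> 'a \<Rightarrow> 'a \<Rightarrow> bool" where
  "free P y b \<longleftrightarrow> E x y \<and> E y b \<and> b \<noteq> x \<and> y \<notin> P \<and> (\<forall>p\<in>P. \<not> E p y \<and> \<not> E p b)"

text \<open>\<open>two_legs P\<close>: two free legs exist that are not adjacent to each other.\<close>

definition two_legs :: "'a set \<Rightarrow> bool" where
  "two_legs P \<longleftrightarrow> (\<exists>y b y' b'. free P y b \<and> free P y' b' \<and> y \<noteq> y' \<and> \<not> E b b')"

lemma two_legs_if_three_free:
  assumes "card {y. \<exists>b. free P y b} > 2"
  shows "two_legs P"
proof -
  obtain y1 y2 y3 b1 b2 b3 where "free P y1 b1" "free P y2 b2" "free P y3 b3"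
      "y1 \<noteq> y2" "y1 \<noteq> y3" "y2 \<noteq> y3"
    by (rule card_gt_2_obtain[OF assms]) blast
  moreover have "\<not> E b1 b2 \<or> \<not> E b1 b3 \<or> \<not> E b2 b3"
    using no_triangle by blast
  ultimately show ?thesis
    unfolding two_legs_def by blast
qed

text \<open>A neighbour of \<open>x\<close> in \<open>P\<close> never obstructs \<open>b\<close>, since \<open>b\<close> has no parent but \<open>y\<close>.\<close>

lemma nbr_of_child_far:
  assumes "x \<notin> P" "p \<in> P" "E p b" "E x y" "E y b" "b \<noteq> x" "y \<notin> P"
  shows "far p"
  using assms by (metis edge_sym far_def parent_unique)

lemma card_covered_le:
  assumes "finite P" "x \<notin> P"
  shows "card {y. E x y \<and> (\<exists>p\<in>P. E p y)} \<le> card P"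
proof -
  have "{y. E x y \<and> (\<exists>p\<in>P. E p y)} = (\<Union>p\<in>P. {y\<in>UNIV. E x y \<and> E p y})" by auto
  moreover have "card {y\<in>UNIV. E x y \<and> E p y} \<le> 1" if "p \<in> P" for p
    using card_parents_le[of p UNIV] that assms(2) by metis
  ultimately show ?thesis
    using card_Union_le_mult[OF assms(1), of "\<lambda>p. {y\<in>UNIV. E x y \<and> E p y}" 1] by simp
qed

text \<open>If no far vertex of \<open>P\<close> is a hub of level 2, then \<open>P\<close> is adjacent to the children of few \<open>y\<close> only.\<close>

lemma two_legs_of_light:
  assumes P: "finite P" "card P \<le> 7" "x \<notin> P"
    and light: "\<And>p. p \<in> P \<Longrightarrow> far p \<Longrightarrow> card (nb2 p) \<le> h"
    and deg: "card {y. E x y} > 7 * h + 16"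
  shows "two_legs P"
proof (rule two_legs_if_three_free)
  let ?C = "{y. E x y \<and> (\<exists>p\<in>P. E p y)}" and ?H = "\<Union>p\<in>P \<inter> Collect far. nb2 p"
    and ?F = "{y. \<exists>b. free P y b}"
  have "{y. E x y} \<subseteq> P \<union> ?C \<union> ?H \<union> ?F"
  proof
    fix y assume y: "y \<in> {y. E x y}"
    show "y \<in> P \<union> ?C \<union> ?H \<union> ?F"
    proof (cases "y \<in> P \<union> ?C \<union> ?H")
      case False
      obtain b where b: "E y b" "b \<noteq> x"
        using child_exists y by (metis mem_Collect_eq)
      then have "free P y b"
        using False y nbr_of_child_far[OF P(3)] by (fastforce simp: free_def nb2_def)
      then show ?thesis by blast
    qed blast
  qed
  then have "card {y. E x y} \<le> card (P \<union> ?C \<union> ?H \<union> ?F)"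
    by (rule card_mono[rotated])
      (use P in \<open>auto simp: free_def intro: rev_finite_subset[OF finite_edge[of x]]\<close>)
  also have "\<dots> \<le> card P + card ?C + card ?H + card ?F"
    by (meson add_mono_thms_linordered_semiring(3) card_Un_le le_trans)
  also have "card ?C \<le> card P"
    using card_covered_le P by blast
  also have "card ?H \<le> card (P \<inter> Collect far) * h"
    using P light by (intro card_Union_le_mult) auto
  also have "\<dots> \<le> 7 * h"
    using P by (intro mult_le_mono1) (meson card_mono inf_le1 le_trans)
  finally show "card ?F > 2"
    using deg P by linarith
qed

text \<open>
  If no child of \<open>y\<close> is free for \<open>P\<close> or \<open>Q\<close>, then \<open>y\<close> lies in \<open>P \<union> Q\<close> (at most 14 cases), is adjacent to it
  (at most 14), or has a child that is the common neighbour of a vertex of \<open>P\<close> and another one of \<open>Q\<close>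
  (at most 49). So there are at least five free \<open>y\<close>, hence at least three for \<open>P\<close> or for \<open>Q\<close>.
\<close>

lemma two_legs_of_two:
  assumes P: "finite P" "card P \<le> 7" "x \<notin> P" and Q: "finite Q" "card Q \<le> 7" "x \<notin> Q"
    and cap: "\<And>v. v \<in> P \<Longrightarrow> v \<in> Q \<Longrightarrow> far v \<Longrightarrow> v = q"
    and deg: "card {y. E x y} > 81"
  shows "two_legs P \<or> two_legs Q"
proof -
  let ?C = "{y. E x y \<and> (\<exists>p\<in>P \<union> Q. E p y)}" 
    and ?D = "\<Union>r\<in>P \<times> Q. {y. \<exists>b. E x y \<and> E y b \<and> b \<noteq> x \<and> fst r \<noteq> snd r \<and> E (fst r) b \<and> E (snd r) b}"
    and ?F = "\<lambda>P. {y. \<exists>b. free P y b}"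
  have "{y. E x y} \<subseteq> (P \<union> Q) \<union> ?C \<union> ?D \<union> (?F P \<union> ?F Q)"
  proof
    fix y assume y: "y \<in> {y. E x y}"
    show "y \<in> (P \<union> Q) \<union> ?C \<union> ?D \<union> (?F P \<union> ?F Q)"
    proof (rule ccontr)
      assume n: "\<not> ?thesis"
      \<comment> \<open>Every child of \<open>y\<close> is adjacent to \<open>P\<close> and to \<open>Q\<close>, hence to the shared vertex \<open>q\<close>.\<close>
      have q: "E q b \<and> q \<noteq> y" if b: "E y b" "b \<noteq> x" for b
      proof -
        have "\<not> free P y b" "\<not> free Q y b"
          using n by auto
        then obtain p p' where p: "p \<in> P" "E p b" "p' \<in> Q" "E p' b"
          using n y b unfolding free_def by auto
        moreover have "p = p'"
        proof (rule ccontr)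
          assume "p \<noteq> p'"
          then have "(p, p') \<in> P \<times> Q" "\<exists>b. E x y \<and> E y b \<and> b \<noteq> x \<and> p \<noteq> p' \<and> E p b \<and> E p' b"
            using p y b by auto
          then show False
            using n by fastforce
        qed
        moreover have "far p"
          using nbr_of_child_far[OF P(3) p(1,2)] y b n by blast
        ultimately show ?thesis
          using cap n by blast
      qed
      obtain b where b: "E y b" "b \<noteq> x"
        using child_exists y by (metis mem_Collect_eq)
      obtain b' where b': "E y b'" "b' \<noteq> x" "b' \<noteq> b"
        using child_exists y by (metis mem_Collect_eq)
      show False
        using common_nbr_unique[of y b b' q] q b b' by metis
    qed
  qed
  then have "card {y. E x y} \<le> card ((P \<union> Q) \<union> ?C \<union> ?D \<union> (?F P \<union> ?F Q))"
    by (rule card_mono[rotated])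
      (use P Q in \<open>auto simp: free_def intro: rev_finite_subset[OF finite_edge[of x]]\<close>)
  also have "\<dots> \<le> card (P \<union> Q) + card ?C + card ?D + (card (?F P) + card (?F Q))"
    by (meson add_mono card_Un_le le_trans order_refl)
  also have "card ?C \<le> card (P \<union> Q)"
    using card_covered_le[of "P \<union> Q"] P Q by blast
  also have "card ?D \<le> card (P \<times> Q) * 1"
  proof (rule card_Union_le_mult)
    fix r
    show "card {y. \<exists>b. E x y \<and> E y b \<and> b \<noteq> x \<and> fst r \<noteq> snd r \<and> E (fst r) b \<and> E (snd r) b} \<le> 1"
      (is "card ?S \<le> 1")
    proof (rule card_le_1I)
      show "finite ?S"
        by (rule finite_subset[OF _ finite_edge[of x]]) auto
      fix y y' assume "y \<in> ?S" "y' \<in> ?S"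
      then obtain b b' where b: "E x y" "E y b" "b \<noteq> x" "fst r \<noteq> snd r" "E (fst r) b" "E (snd r) b"
          "E x y'" "E y' b'" "b' \<noteq> x" "E (fst r) b'" "E (snd r) b'"
        by blast
      then have "b = b'"
        using common_nbr_unique by blast
      then show "y = y'"
        using b parent_unique[of y y' b] edge_sym by blast
    qed
  qed (use P Q in auto)
  also have "card (P \<times> Q) * 1 \<le> 7 * 7"
    using P Q mult_le_mono[of "card P" 7 "card Q" 7] by (simp add: card_cartesian_product)
  finally have "card (?F P) > 2 \<or> card (?F Q) > 2"
    using deg P Q card_Un_le[of P Q] by linarith
  then show ?thesis
    using two_legs_if_three_free by blast
qed

text \<open>
  Each of the three trees is obtained from a tail at \<open>x = u\<^sub>3\<close> and two free legs.
\<close>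

lemma embeds_T9_centre:
  assumes "E x u4" "E u4 u5" "E u5 u6" "E u6 u7" "E u7 u8" "E u8 u9"
    and "x \<noteq> u5" "u4 \<noteq> u6" "u5 \<noteq> u7" "u6 \<noteq> u8" "u7 \<noteq> u9"
    and "far u7" "far u8" "far u9" "\<not> E u4 u8" "\<not> E u4 u9" "\<not> E u5 u9"
    and "two_legs {u4, u5, u6, u7, u8, u9}"
  shows "embeds (T_graph 9)"
proof -
  obtain y b y' b' where f: "free {u4, u5, u6, u7, u8, u9} y b" "free {u4, u5, u6, u7, u8, u9} y' b'"
      "y \<noteq> y'" "\<not> E b b'"
    using assms unfolding two_legs_def by blast
  show ?thesis
    by (rule embeds_T9I[of b y x u4 u5 u6 u7 u8 u9 y' b'])
      (use assms f in \<open>auto simp: free_def far_def dest: edge_sym\<close>)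
qed

lemma embeds_T8_2_centre:
  assumes "E x u4" "E u4 u5" "E u5 u6" "E u6 u7" "E u7 u8" "E u4 w"
    and "x \<noteq> u5" "x \<noteq> w" "u5 \<noteq> w" "u4 \<noteq> u6" "u5 \<noteq> u7" "u6 \<noteq> u8"
    and "far u7" "far u8" "\<not> E u4 u8" "\<not> E w u7" "\<not> E w u8"
    and "two_legs {u4, u5, u6, u7, u8, w}"
  shows "embeds T8_2"
proof -
  obtain y b y' b' where f: "free {u4, u5, u6, u7, u8, w} y b" "free {u4, u5, u6, u7, u8, w} y' b'"
      "y \<noteq> y'" "\<not> E b b'"
    using assms unfolding two_legs_def by blast
  show ?thesis
    by (rule embeds_T8_2I[of b y x u4 u5 u6 u7 u8 y' b' w])
      (use assms f in \<open>auto simp: free_def far_def dest: edge_sym\<close>)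
qed

lemma embeds_T8_1_centre:
  assumes "E x u4" "E u4 u5" "E u5 u6" "E u6 u7" "E u7 u8" "E u5 a" "E u6 b"
    and "x \<noteq> u5" "u4 \<noteq> u6" "u5 \<noteq> u7" "u6 \<noteq> u8" "u4 \<noteq> a" "u6 \<noteq> a" "u5 \<noteq> b" "u7 \<noteq> b"
    and "far u7" "far u8" "far b" "\<not> E u4 u8" "\<not> E a u8"
    and "two_legs {u4, u5, u6, u7, u8, a, b}"
  shows "embeds T8_1"
proof -
  obtain y c y' c' where f: "free {u4, u5, u6, u7, u8, a, b} y c" "free {u4, u5, u6, u7, u8, a, b} y' c'"
      "y \<noteq> y'" "\<not> E c c'"
    using assms unfolding two_legs_def by blast
  show ?thesis
    by (rule embeds_T8_1I[of c y x u4 u5 u6 u7 u8 y' c' a b])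
      (use assms f in \<open>auto simp: free_def far_def dest: edge_sym\<close>)
qed

end

section \<open>Hubs of level 2\<close>

context rooted_girth5_graph
begin

text \<open>
  Notation: for \<open>y\<close> in \<open>nb2 p\<close>, the path \<open>y, a y, p\<close> leads to the hub, \<open>c y\<close> is a further neighbour of
  \<open>a y\<close>, and \<open>d y\<close> a further far neighbour of \<open>c y\<close>. The tail \<open>x, i, a i, p, a j, c j, d j\<close> can be chosen
  twice with only \<open>p\<close> in common, unless all \<open>d j\<close> coincide. If they are all equal to \<open>q\<close>, the tail
  \<open>x, i, a i, c i, q, c j, a j\<close> can be chosen twice with only \<open>q\<close> in common. Every index conflicts with
  at most four others, so 36 indices contain four without conflicts.
\<close>

lemma embeds_T9_of_hub2:
  assumes p: "far p" and card: "card (nb2 p) \<ge> 36" and deg: "card {y. E x y} > 81"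
  shows "embeds (T_graph 9)"
proof -
  let ?I = "nb2 p"
  have "\<exists>a c d. E x y \<and> E y a \<and> a \<noteq> x \<and> E p a \<and> E a c \<and> c \<noteq> y \<and> c \<noteq> p \<and> E c d \<and> d \<noteq> a \<and> far d"
    if y: "y \<in> ?I" for y
  proof -
    obtain a where a: "E x y" "E y a" "a \<noteq> x" "E p a"
      using y by (auto simp: nb2_def)
    obtain c where c: "E a c" "c \<noteq> y" "c \<noteq> p"
      using third_nbr[of a] a edge_in_V2 by blast
    moreover have "far c"
      using grandchild_far a c by blast
    ultimately show ?thesis
      using far_nbr_exists[of c a] a edge_in_V2 by metis
  qed
  then obtain a c d where acd: "\<And>y. y \<in> ?I \<Longrightarrow> E x y \<and> E y (a y) \<and> a y \<noteq> x \<and> E p (a y) \<and>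
      E (a y) (c y) \<and> c y \<noteq> y \<and> c y \<noteq> p \<and> E (c y) (d y) \<and> d y \<noteq> a y \<and> far (d y)"
    by metis
  have far: "far (a y)" "far (c y)" "far (d y)" if "y \<in> ?I" for y
    using acd[OF that] child_far grandchild_far by blast+
  have a_inj: "i = j" if "i \<in> ?I" "j \<in> ?I" "a i = a j" for i j
    using acd[OF that(1)] acd[OF that(2)] that(3) parent_unique edge_sym by metis
  have ca: "i = j" if "i \<in> ?I" "j \<in> ?I" "E (c i) (a j)" for i j
    using acd[OF that(1)] acd[OF that(2)] that common_nbr_unique[of "c i" "a i" "a j" p] a_inj edge_sym
    by blast
  have c_inj: "i = j" if "i \<in> ?I" "j \<in> ?I" "c i = c j" for i j
    using ca[OF that(1,2)] acd[OF that(2)] that(3) edge_sym by metis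
  have aa: "\<not> E (a i) (a j)" if "i \<in> ?I" "j \<in> ?I" for i j
    using acd[OF that(1)] acd[OF that(2)] no_triangle by blast
  have ac: "a i \<noteq> c j" if "i \<in> ?I" "j \<in> ?I" for i j
    using aa[OF that(2,1)] acd[OF that(2)] by metis
  have ad: "a i \<noteq> d j" if "i \<in> ?I" "j \<in> ?I" for i j
    using ca[OF that(2,1)] acd[OF that(2)] by metis
  have ia: "i = j" if "i \<in> ?I" "j \<in> ?I" "E i (a j)" for i j
    using parent_unique[of i j "a j"] acd[OF that(1)] acd[OF that(2)] that(3) edge_sym by blast
  have pd: "p \<noteq> d i" if "i \<in> ?I" for i
    using acd[OF that] no_triangle edge_sym by metis
  define R where "R i j \<longleftrightarrow> (E (c i) j \<or> E (d i) j) \<or> (E (d i) (a j) \<or> d i = c j)" for i j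
  have out: "card {j\<in>?I. R i j} \<le> (1 + 1) + (1 + 1)" if i: "i \<in> ?I" for i
    unfolding R_def
  proof (intro card_Collect_disj_le card_le_1I)
    fix j k assume "j \<in> {j\<in>?I. E (c i) j}" "k \<in> {j\<in>?I. E (c i) j}"
    then show "j = k"
      using parent_unique[of j k "c i"] acd far(2)[OF i] farD(1) by blast
  next
    fix j k assume "j \<in> {j\<in>?I. E (d i) j}" "k \<in> {j\<in>?I. E (d i) j}"
    then show "j = k"
      using parent_unique[of j k "d i"] acd far(3)[OF i] farD(1) by blast
  next
    fix j k assume "j \<in> {j\<in>?I. E (d i) (a j)}" "k \<in> {j\<in>?I. E (d i) (a j)}"
    then show "j = k"
      using common_nbr_unique[of "d i" "a j" "a k" p] acd pd[OF i] a_inj by blast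
  next
    fix j k assume "j \<in> {j\<in>?I. d i = c j}" "k \<in> {j\<in>?I. d i = c j}"
    then show "j = k"
      using c_inj by auto
  qed auto
  have "\<exists>B\<subseteq>?I. card B = 4 \<and> (\<forall>i\<in>B. \<forall>j\<in>B. i \<noteq> j \<longrightarrow> \<not> R i j)"
    by (rule independent_subset[where R = "R", OF _ out]) (use card in auto)
  then obtain B where B: "B \<subseteq> ?I" "card B = 4" "\<forall>i\<in>B. \<forall>j\<in>B. i \<noteq> j \<longrightarrow> \<not> R i j"
    by blast
  obtain xs where xs: "distinct xs" "set xs = B" "length xs = 4"
    using card_distinct_list[OF B(2)] by auto
  have nR: "\<not> E (c i) j" "\<not> E (d i) j" "\<not> E (d i) (a j)" "d i \<noteq> c j" "\<not> E j (c i)" "\<not> E j (d i)"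
      "\<not> E (a j) (d i)"
    if "i \<in> B" "j \<in> B" "i \<noteq> j" for i j
    using B(3) that edge_sym unfolding R_def by blast+
  have I: "i \<in> ?I" if "i \<in> B" for i
    using that B(1) by blast
  note facts = acd[OF I] far[OF I] nR
  have path1: "embeds (T_graph 9)"
    if "two_legs {i, a i, p, a j, c j, d j}" "i \<in> B" "j \<in> B" "i \<noteq> j" for i j
    by (rule embeds_T9_centre[of i "a i" p "a j" "c j" "d j"])
      (use that facts[of i] facts[of j] p a_inj[OF I I, of i j] nR[of j i] in
        \<open>auto simp: farD dest: edge_sym\<close>)
  have path2: "embeds (T_graph 9)"
    if "two_legs {i, a i, c i, q, c j, a j}" "i \<in> B" "j \<in> B" "i \<noteq> j" "d i = q" "d j = q" for i j q
    by (rule embeds_T9_centre[of i "a i" "c i" q "c j" "a j"])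
      (use that facts[of i] facts[of j] p c_inj[OF I I, of i j] nR[of j i] aa[OF I I, of i j]
          ia[OF I I, of i j] in
        \<open>auto simp: farD dest: edge_sym\<close>)
  have ne1: "x \<noteq> i" "x \<noteq> a i" "x \<noteq> c i" "x \<noteq> d i" "\<not> far i" if "i \<in> B" for i
    using facts(1)[OF that] facts(2-4)[OF that] edge_neq by (auto simp: far_def)
  have ne2: "a i \<noteq> a j" "c i \<noteq> c j" "a i \<noteq> c j" "c i \<noteq> a j" "a i \<noteq> d j" "d i \<noteq> a j" "d i \<noteq> c j"
      "c i \<noteq> d j"
    if "i \<in> B" "j \<in> B" "i \<noteq> j" for i j
    using that a_inj[OF I I, of i j] c_inj[OF I I, of i j] ac[OF I I] ad[OF I I] nR(4)[of i j] nR(4)[of j i]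
    by metis+
  show ?thesis
  proof (cases "\<exists>i\<in>B. \<exists>j\<in>B. d i \<noteq> d j")
    case True
    then obtain i j where ij: "i \<in> B" "j \<in> B" "i \<noteq> j" "d i \<noteq> d j" by blast
    have "card (B - {i, j}) = 2"
      using B(2) ij by (simp add: card_Diff_subset)
    then obtain k l where kl: "k \<in> B" "l \<in> B" "k \<noteq> l" "k \<notin> {i, j}" "l \<notin> {i, j}"
      unfolding card_2_iff by blast
    have "two_legs {k, a k, p, a i, c i, d i} \<or> two_legs {l, a l, p, a j, c j, d j}"
      by (rule two_legs_of_two[where q = p])
        (use ij kl deg in \<open>auto simp: card_le_7 ne1 ne2 farD(2)[OF p]\<close>)
    then show ?thesis
      using path1[of k i] path1[of l j] ij kl by blast
  next
    case False
    obtain i j k l where "xs = [i, j, k, l]"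
      using xs(3) by (auto simp: eval_nat_numeral length_Suc_conv)
    then have b: "i \<in> B" "j \<in> B" "k \<in> B" "l \<in> B"
        and n: "i \<noteq> j" "k \<noteq> l" "i \<noteq> k" "i \<noteq> l" "j \<noteq> k" "j \<noteq> l"
      using xs by auto
    have d: "d j = d i" "d k = d i" "d l = d i"
      using False b by blast+
    have "two_legs {i, a i, c i, d i, c j, a j} \<or> two_legs {k, a k, c k, d k, c l, a l}"
      by (rule two_legs_of_two[where q = "d i"])
        (use b n d deg in \<open>auto simp: card_le_7 ne1 ne2\<close>)
    then show ?thesis
      using path2[of i "d i" j] path2[of k "d i" l] b n d by auto
  qed
qed


text \<open>
  The tail is \<open>x, i, a i, p, a j, c j\<close>, and a second child \<open>b i\<close> of \<open>i\<close> serves as \<open>w\<^sub>4\<close>. Adjacency of \<open>b i\<close>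
  and \<open>c j\<close> is not a sparse relation, but any two \<open>i\<close> and two \<open>j\<close> contain a non-adjacent pair.
\<close>

lemma embeds_T8_2_of_hub2:
  assumes p: "far p" and card: "card (nb2 p) \<ge> 40" and deg: "card {y. E x y} > 81"
  shows "embeds T8_2"
proof -
  let ?I = "nb2 p"
  have "\<exists>a b c. E x y \<and> E y a \<and> a \<noteq> x \<and> E p a \<and> E y b \<and> b \<noteq> x \<and> b \<noteq> a \<and> E a c \<and> c \<noteq> y \<and> c \<noteq> p"
    if y: "y \<in> ?I" for y
  proof -
    obtain a where a: "E x y" "E y a" "a \<noteq> x" "E p a"
      using y by (auto simp: nb2_def)
    moreover obtain c where "E a c" "c \<noteq> y" "c \<noteq> p"
      using third_nbr[of a] a edge_in_V2 by blast
    ultimately show ?thesis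
      using child_exists[of y a] by metis
  qed
  then obtain a b c where abc: "\<And>y. y \<in> ?I \<Longrightarrow> E x y \<and> E y (a y) \<and> a y \<noteq> x \<and> E p (a y) \<and>
      E y (b y) \<and> b y \<noteq> x \<and> b y \<noteq> a y \<and> E (a y) (c y) \<and> c y \<noteq> y \<and> c y \<noteq> p"
    by metis
  have far: "far (a y)" "far (b y)" "far (c y)" if "y \<in> ?I" for y
    using abc[OF that] child_far grandchild_far by blast+
  have a_inj: "i = j" if "i \<in> ?I" "j \<in> ?I" "a i = a j" for i j
    using abc[OF that(1)] abc[OF that(2)] that(3) parent_unique edge_sym by metis
  have b_inj: "i = j" if "i \<in> ?I" "j \<in> ?I" "b i = b j" for i j
    using abc[OF that(1)] abc[OF that(2)] that(3) parent_unique edge_sym by metis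
  have ab: "a i \<noteq> b j" if "i \<in> ?I" "j \<in> ?I" for i j
    using abc[OF that(1)] abc[OF that(2)] parent_unique edge_sym by metis
  have ca: "i = j" if "i \<in> ?I" "j \<in> ?I" "E (c i) (a j)" for i j
    using abc[OF that(1)] abc[OF that(2)] that common_nbr_unique[of "c i" "a i" "a j" p] a_inj edge_sym
    by blast
  have c_inj: "i = j" if "i \<in> ?I" "j \<in> ?I" "c i = c j" for i j
    using ca[OF that(1,2)] abc[OF that(2)] that(3) edge_sym by metis
  have aa: "\<not> E (a i) (a j)" if "i \<in> ?I" "j \<in> ?I" for i j
    using abc[OF that(1)] abc[OF that(2)] no_triangle by blast
  have ac: "a i \<noteq> c j" if "i \<in> ?I" "j \<in> ?I" for i j
    using aa[OF that(2,1)] abc[OF that(2)] by metis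
  have pb: "p \<noteq> b i" if "i \<in> ?I" for i
    using abc[OF that] no_triangle edge_sym by metis
  define R where "R i j \<longleftrightarrow> E (b i) (a j) \<or> E (c i) j" for i j
  have out: "card {j\<in>?I. R i j} \<le> 1 + 1" if i: "i \<in> ?I" for i
    unfolding R_def
  proof (intro card_Collect_disj_le card_le_1I)
    fix j k assume "j \<in> {j\<in>?I. E (b i) (a j)}" "k \<in> {j\<in>?I. E (b i) (a j)}"
    then show "j = k"
      using common_nbr_unique[of "b i" "a j" "a k" p] abc pb[OF i] a_inj by blast
  next
    fix j k assume "j \<in> {j\<in>?I. E (c i) j}" "k \<in> {j\<in>?I. E (c i) j}"
    then show "j = k"
      using parent_unique[of j k "c i"] abc far(3)[OF i] farD(1) by blast
  qed auto
  have "\<exists>B\<subseteq>?I. card B = 8 \<and> (\<forall>i\<in>B. \<forall>j\<in>B. i \<noteq> j \<longrightarrow> \<not> R i j)"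
    by (rule independent_subset[where R = "R", OF _ out]) (use card in auto)
  then obtain B where B: "B \<subseteq> ?I" "card B = 8" "\<forall>i\<in>B. \<forall>j\<in>B. i \<noteq> j \<longrightarrow> \<not> R i j"
    by blast
  obtain xs where xs: "distinct xs" "set xs = B" "length xs = 8"
    using card_distinct_list[OF B(2)] by auto
  have nR: "\<not> E (b i) (a j)" "\<not> E (c i) j" if "i \<in> B" "j \<in> B" "i \<noteq> j" for i j
    using B(3) that edge_sym unfolding R_def by blast+
  have I: "i \<in> ?I" if "i \<in> B" for i
    using that B(1) by blast
  note facts = abc[OF I] far[OF I] nR
  have path: "embeds T8_2"
    if "two_legs {i, a i, p, a j, c j, b i}" "i \<in> B" "j \<in> B" "i \<noteq> j" "\<not> E (b i) (c j)" for i j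
    by (rule embeds_T8_2_centre[of i "a i" p "a j" "c j" "b i"])
      (use that facts[of i] facts[of j] p a_inj[OF I I, of i j] nR[of i j] nR[of j i] in
        \<open>auto simp: farD dest: edge_sym\<close>)
  have bc: "b i \<noteq> c j" if "i \<in> B" "j \<in> B" "i \<noteq> j" for i j
    using nR(2)[of j i] facts(1)[of i] that edge_sym by metis
  have ne1: "x \<noteq> i" "x \<noteq> a i" "x \<noteq> b i" "x \<noteq> c i" "\<not> far i" if "i \<in> B" for i
    using facts(1)[OF that] facts(2-4)[OF that] edge_neq by (auto simp: far_def)
  have ne2: "a i \<noteq> a j" "b i \<noteq> b j" "c i \<noteq> c j" "a i \<noteq> b j" "b i \<noteq> a j" "a i \<noteq> c j" "c i \<noteq> a j"
      "b i \<noteq> c j" "c i \<noteq> b j"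
    if "i \<in> B" "j \<in> B" "i \<noteq> j" for i j
    using that a_inj[OF I I, of i j] b_inj[OF I I, of i j] c_inj[OF I I, of i j] ab[OF I I] ac[OF I I]
      bc[of i j] bc[of j i] by metis+
  \<comment> \<open>Otherwise \<open>b i, c k, b j, c l\<close> would be a 4-cycle.\<close>
  have pick: "\<exists>i'\<in>{i, j}. \<exists>k'\<in>{k, l}. \<not> E (b i') (c k')"
    if "{i, j, k, l} \<subseteq> B" "i \<noteq> j" "k \<noteq> l" for i j k l
  proof (rule ccontr)
    assume "\<not> ?thesis"
    then have "E (b i) (c k)" "E (b i) (c l)" "E (b j) (c k)" "E (b j) (c l)" by auto
    then show False
      using common_nbr_unique[of "b i" "c k" "c l" "b j"] that b_inj[OF I I] c_inj[OF I I] by auto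
  qed
  obtain i j k l i' j' k' l' where "xs = [i, j, k, l, i', j', k', l']"
    using xs(3) by (auto simp: eval_nat_numeral length_Suc_conv)
  then have b: "{i, j, k, l} \<subseteq> B" "{i', j', k', l'} \<subseteq> B" and d: "distinct [i, j, k, l, i', j', k', l']"
    using xs by auto
  obtain m n where mn: "m \<in> {i, j}" "n \<in> {k, l}" "\<not> E (b m) (c n)"
    using pick[of i j k l] b d by auto
  obtain m' n' where mn': "m' \<in> {i', j'}" "n' \<in> {k', l'}" "\<not> E (b m') (c n')"
    using pick[of i' j' k' l'] b d by auto
  have m: "m \<in> B" "n \<in> B" "m' \<in> B" "n' \<in> B"
    and ne: "m \<noteq> n" "m' \<noteq> n'" "m \<noteq> m'" "m \<noteq> n'" "n \<noteq> m'" "n \<noteq> n'"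
    using mn mn' b d by auto
  have "two_legs {m, a m, p, a n, c n, b m} \<or> two_legs {m', a m', p, a n', c n', b m'}"
    by (rule two_legs_of_two[where q = p])
      (use m ne deg in \<open>auto simp: card_le_7 ne1 ne2 farD(2)[OF p]\<close>)
  then show ?thesis
    using path[of m n] path[of m' n'] m ne mn mn' by blast
qed

text \<open>The tail is \<open>x, i, a i, p, a j, c j\<close>, with \<open>c i\<close> as \<open>w\<^sub>5\<close> and some \<open>a k\<close> as \<open>w\<^sub>6\<close>. Among any three
  indices there are two with non-adjacent \<open>c i\<close> and \<open>c j\<close>.\<close>

lemma embeds_T8_1_of_hub2:
  assumes p: "far p" and card: "card (nb2 p) \<ge> 18" and deg: "card {y. E x y} > 81"
  shows "embeds T8_1"
proof -
  let ?I = "nb2 p"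
  have "\<exists>a c. E x y \<and> E y a \<and> a \<noteq> x \<and> E p a \<and> E a c \<and> c \<noteq> y \<and> c \<noteq> p"
    if y: "y \<in> ?I" for y
  proof -
    obtain a where a: "E x y" "E y a" "a \<noteq> x" "E p a"
      using y by (auto simp: nb2_def)
    moreover obtain c where "E a c" "c \<noteq> y" "c \<noteq> p"
      using third_nbr[of a] a edge_in_V2 by blast
    ultimately show ?thesis
      by metis
  qed
  then obtain a c where ac': "\<And>y. y \<in> ?I \<Longrightarrow> E x y \<and> E y (a y) \<and> a y \<noteq> x \<and> E p (a y) \<and>
      E (a y) (c y) \<and> c y \<noteq> y \<and> c y \<noteq> p"
    by metis
  have far: "far (a y)" "far (c y)" if "y \<in> ?I" for y
    using ac'[OF that] child_far grandchild_far by blast+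
  have a_inj: "i = j" if "i \<in> ?I" "j \<in> ?I" "a i = a j" for i j
    using ac'[OF that(1)] ac'[OF that(2)] that(3) parent_unique edge_sym by metis
  have ca: "i = j" if "i \<in> ?I" "j \<in> ?I" "E (c i) (a j)" for i j
    using ac'[OF that(1)] ac'[OF that(2)] that common_nbr_unique[of "c i" "a i" "a j" p] a_inj edge_sym
    by blast
  have c_inj: "i = j" if "i \<in> ?I" "j \<in> ?I" "c i = c j" for i j
    using ca[OF that(1,2)] ac'[OF that(2)] that(3) edge_sym by metis
  have aa: "\<not> E (a i) (a j)" if "i \<in> ?I" "j \<in> ?I" for i j
    using ac'[OF that(1)] ac'[OF that(2)] no_triangle by blast
  have ac: "a i \<noteq> c j" if "i \<in> ?I" "j \<in> ?I" for i j
    using aa[OF that(2,1)] ac'[OF that(2)] by metis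
  have out: "card {j\<in>?I. E (c i) j} \<le> 1" if i: "i \<in> ?I" for i
    using ac' parent_unique[of _ _ "c i"] far(2)[OF i] farD(1) by (intro card_le_1I) auto
  have "\<exists>B\<subseteq>?I. card B = 6 \<and> (\<forall>i\<in>B. \<forall>j\<in>B. i \<noteq> j \<longrightarrow> \<not> E (c i) j)"
    by (rule independent_subset[where R = "\<lambda>i j. E (c i) j", OF _ out]) (use card in auto)
  then obtain B where B: "B \<subseteq> ?I" "card B = 6" "\<forall>i\<in>B. \<forall>j\<in>B. i \<noteq> j \<longrightarrow> \<not> E (c i) j"
    by blast
  obtain xs where xs: "distinct xs" "set xs = B" "length xs = 6"
    using card_distinct_list[OF B(2)] by auto
  have I: "i \<in> ?I" if "i \<in> B" for i
    using that B(1) by blast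
  note facts = ac'[OF I] far[OF I]
  have path: "embeds T8_1"
    if "two_legs {i, a i, p, a j, c j, c i, a k}" "i \<in> B" "j \<in> B" "k \<in> B" "distinct [i, j, k]"
      "\<not> E (c i) (c j)" for i j k
    by (rule embeds_T8_1_centre[of i "a i" p "a j" "c j" "c i" "a k"])
      (use that facts[of i] facts[of j] facts[of k] p a_inj[OF I I, of i j] a_inj[OF I I, of i k]
         a_inj[OF I I, of j k] B(3) in \<open>auto simp: farD dest: edge_sym\<close>)
  have ne1: "x \<noteq> i" "x \<noteq> a i" "x \<noteq> c i" "\<not> far i" if "i \<in> B" for i
    using facts(1)[OF that] facts(2-3)[OF that] edge_neq by (auto simp: far_def)
  have ne2: "a i \<noteq> a j" "c i \<noteq> c j" "a i \<noteq> c j" "c i \<noteq> a j"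
    if "i \<in> B" "j \<in> B" "i \<noteq> j" for i j
    using that a_inj[OF I I, of i j] c_inj[OF I I, of i j] ac[OF I I] by metis+
  have pick: "\<exists>i' j' k'. {i', j', k'} \<subseteq> {i, j, k} \<and> distinct [i', j', k'] \<and> \<not> E (c i') (c j')"
    if "distinct [i, j, k]" for i j k
  proof -
    consider "\<not> E (c i) (c j)" | "\<not> E (c i) (c k)" | "\<not> E (c j) (c k)"
      using no_triangle by blast
    then show ?thesis
    proof cases
      case 1 then show ?thesis using that by (intro exI[of _ i] exI[of _ j] exI[of _ k]) auto
    next
      case 2 then show ?thesis using that by (intro exI[of _ i] exI[of _ k] exI[of _ j]) auto
    next
      case 3 then show ?thesis using that by (intro exI[of _ j] exI[of _ k] exI[of _ i]) auto
    qed
  qed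
  obtain i j k i' j' k' where "xs = [i, j, k, i', j', k']"
    using xs(3) by (auto simp: eval_nat_numeral length_Suc_conv)
  then have b: "{i, j, k} \<subseteq> B" "{i', j', k'} \<subseteq> B" and d: "distinct [i, j, k, i', j', k']"
    using xs by auto
  obtain l m n where lmn: "{l, m, n} \<subseteq> {i, j, k}" "distinct [l, m, n]" "\<not> E (c l) (c m)"
    using pick[of i j k] d by auto
  obtain l' m' n' where lmn': "{l', m', n'} \<subseteq> {i', j', k'}" "distinct [l', m', n']" "\<not> E (c l') (c m')"
    using pick[of i' j' k'] d by auto
  have m: "l \<in> B" "m \<in> B" "n \<in> B" "l' \<in> B" "m' \<in> B" "n' \<in> B"
    using lmn(1) lmn'(1) b by auto
  have "{l, m, n} \<inter> {l', m', n'} = {}"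
    using lmn(1) lmn'(1) d by auto
  then have "two_legs {l, a l, p, a m, c m, c l, a n} \<or> two_legs {l', a l', p, a m', c m', c l', a n'}"
    by (intro two_legs_of_two[where q = p])
      (use m deg in \<open>auto simp: card_le_7 ne1 ne2 farD(2)[OF p]\<close>)
  then show ?thesis
    using path[of l m n] path[of l' m' n'] m lmn lmn' by blast
qed

end

section \<open>Hubs of levels 3 and 4\<close>

context rooted_girth5_graph
begin

lemma card_nbrs_le:
  assumes "finite J" "far p" "\<And>y. y \<in> J \<Longrightarrow> E x y"
  shows "card {y\<in>J. E p y} \<le> 1"
  using assms parent_unique[of _ _ p] farD(1)[OF assms(2)] by (intro card_le_1I) auto

lemma hub3_far: "hub3 p y z w \<Longrightarrow> far z" "hub3 p y z w \<Longrightarrow> far w"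
  unfolding hub3_def using child_far grandchild_far by blast+

lemma hub4_far: "hub4 p y z w t \<Longrightarrow> far z" "hub4 p y z w t \<Longrightarrow> far w" "hub4 p y z w t \<Longrightarrow> far t"
  unfolding hub4_def using child_far grandchild_far by blast+

text \<open>
  Without hubs of level \<open>k\<close>, a hub of level \<open>k + 1\<close> is reached through many different neighbours of it:
  if many paths had the same last vertex before \<open>p\<close>, that vertex would be a hub of level \<open>k\<close>.
\<close>

lemma hub3_inj:
  assumes light: "\<And>q. far q \<Longrightarrow> card (nb2 q) \<le> h" and card: "card (nb3 p) > r * h"
  obtains J z w where "finite J" "card J > r" "inj_on w J" "\<And>y. y \<in> J \<Longrightarrow> hub3 p y (z y) (w y)"
proof -
  have "\<exists>z w. hub3 p y z w" if "y \<in> nb3 p" for y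
    using that by (auto simp: nb3_def)
  then obtain z w where zw: "\<And>y. y \<in> nb3 p \<Longrightarrow> hub3 p y (z y) (w y)"
    by metis
  have "card {y\<in>nb3 p. w y = v} \<le> h" for v
  proof (cases "\<exists>y\<in>nb3 p. w y = v")
    case True
    then have "far v"
      using zw hub3_far(2) by blast
    have "{y\<in>nb3 p. w y = v} \<subseteq> nb2 v"
      using zw unfolding nb2_def hub3_def by (blast intro: edge_sym)
    then show ?thesis
      using light[OF \<open>far v\<close>] card_mono[OF finite_nb(1)] le_trans by blast
  next
    case False
    then have "{y\<in>nb3 p. w y = v} = {}" by blast
    then show ?thesis by (metis card.empty le0)
  qed
  then obtain J where "J \<subseteq> nb3 p" "inj_on w J" "card J > r"
    using inj_on_subset_of_small_fibres[OF finite_nb(2) _ card] by metis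
  then show thesis
    using that zw finite_subset[OF _ finite_nb(2)] by (meson subsetD)
qed

lemma nb4_choice:
  obtains z w t where "\<And>y. y \<in> nb4 p \<Longrightarrow> hub4 p y (z y) (w y) (t y)"
proof -
  have "\<exists>z w t. hub4 p y z w t" if "y \<in> nb4 p" for y
    using that by (auto simp: nb4_def)
  then obtain z w t where "\<And>y. y \<in> nb4 p \<Longrightarrow> hub4 p y (z y) (w y) (t y)"
    by metis
  then show thesis by (rule that)
qed

lemma hub4_inj:
  assumes light: "\<And>q. far q \<Longrightarrow> card (nb3 q) \<le> h" and I: "finite I" and card: "card I > r * h"
    and hub: "\<And>y. y \<in> I \<Longrightarrow> hub4 p y (z y) (w y) (t y)"
  obtains J where "J \<subseteq> I" "card J > r" "inj_on t J"
proof -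
  have "card {y\<in>I. t y = v} \<le> h" for v
  proof (cases "\<exists>y\<in>I. t y = v")
    case True
    then have "far v"
      using hub hub4_far(3) by blast
    have "{y\<in>I. t y = v} \<subseteq> nb3 v"
      using hub unfolding nb3_def hub3_def hub4_def by (blast intro: edge_sym)
    then show ?thesis
      using light[OF \<open>far v\<close>] card_mono[OF finite_nb(2)] le_trans by blast
  next
    case False
    then have "{y\<in>I. t y = v} = {}" by blast
    then show ?thesis by (metis card.empty le0)
  qed
  then show thesis
    using inj_on_subset_of_small_fibres[OF I _ card] that by metis
qed

text \<open>Neighbours of \<open>p\<close> at distance two from \<open>x\<close> have different parents, which lie in \<open>nb2 p\<close>.\<close>

lemma card_with_parent_le:
  assumes "finite J" "far p" "inj_on w J" "\<And>y. y \<in> J \<Longrightarrow> far (w y) \<and> E p (w y)"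
  shows "card {y\<in>J. \<exists>g. E x g \<and> E (w y) g} \<le> card (nb2 p)"
proof -
  let ?K = "{y\<in>J. \<exists>g. E x g \<and> E (w y) g}"
  define g where "g y = (SOME g. E x g \<and> E (w y) g)" for y
  have g: "\<And>y. y \<in> ?K \<Longrightarrow> E x (g y) \<and> E (w y) (g y)"
    unfolding g_def by (rule someI_ex) blast
  have "inj_on g ?K"
  proof (rule inj_onI)
    fix i j assume ij: "i \<in> ?K" "j \<in> ?K" "g i = g j"
    moreover have "g i \<noteq> p"
      using g[OF ij(1)] assms(2) farD by blast
    ultimately have "w i = w j"
      using g[OF ij(1)] g[OF ij(2)] assms(4) common_nbr_unique[of p "w i" "w j" "g i"] edge_sym
      by (metis (no_types, lifting) mem_Collect_eq)
    then show "i = j"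
      using assms(3) ij by (auto dest: inj_onD)
  qed
  moreover have "g ` ?K \<subseteq> nb2 p"
    using g assms(4) edge_sym farD unfolding nb2_def by blast
  ultimately show ?thesis
    using card_inj_on_le finite_nb(1) by blast
qed

text \<open>The tail is \<open>x, i, z i, w i, p, w j, z j\<close>.\<close>

lemma embeds_T9_of_hub3:
  assumes p: "far p" and light: "\<And>q. far q \<Longrightarrow> card (nb2 q) \<le> h" and card: "card (nb3 p) > 8 * h"
    and deg: "card {y. E x y} > 7 * h + 16"
  shows "embeds (T_graph 9)"
proof -
  obtain J z w where J: "finite J" "card J > 8" "inj_on w J" and hub: "\<And>y. y \<in> J \<Longrightarrow> hub3 p y (z y) (w y)"
    using hub3_inj[OF light card] by metis
  note far = hub3_far[OF hub]
  have out: "card {j\<in>J. E (w i) j} \<le> 1" if "i \<in> J" for i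
    using J(1) hub parent_unique[of _ _ "w i"] farD(1)[OF far(2)[OF that]]
    by (intro card_le_1I) (auto simp: hub3_def)
  have "\<exists>B\<subseteq>J. card B = 3 \<and> (\<forall>i\<in>B. \<forall>j\<in>B. i \<noteq> j \<longrightarrow> \<not> E (w i) j)"
    by (rule independent_subset[where R = "\<lambda>i j. E (w i) j", OF J(1) out]) (use J in auto)
  then obtain B where B: "B \<subseteq> J" "card B = 3" "\<forall>i\<in>B. \<forall>j\<in>B. i \<noteq> j \<longrightarrow> \<not> E (w i) j"
    by blast
  obtain i1 i2 i3 where i: "{i1, i2, i3} \<subseteq> B" "i1 \<noteq> i2" "i1 \<noteq> i3" "i2 \<noteq> i3"
    using B(2) unfolding card_3_iff by auto
  have "\<not> E (z i1) (z i2) \<or> \<not> E (z i1) (z i3) \<or> \<not> E (z i2) (z i3)"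
    using no_triangle by blast
  then obtain i j where ij: "i \<in> B" "j \<in> B" "i \<noteq> j" "\<not> E (z i) (z j)"
    using i by auto
  have hi: "hub3 p i (z i) (w i)" and hj: "hub3 p j (z j) (w j)"
    using ij B(1) hub by auto
  have fi: "far (z i)" "far (w i)" and fj: "far (z j)" "far (w j)"
    using hub3_far[OF hi] hub3_far[OF hj] by auto
  have w: "w i \<noteq> w j"
    using J(3) B(1) ij by (auto dest: inj_onD)
  have iz: "\<not> E i (z j)"
    using parent_unique[of i j "z j"] hi hj ij edge_sym unfolding hub3_def by blast
  have wj: "\<not> E i (w j)"
    using B(3) ij not_edge_sym[of "w j" i] by auto
  show ?thesis
  proof (rule embeds_T9_centre[of i "z i" "w i" p "w j" "z j"])
    show "two_legs {i, z i, w i, p, w j, z j}"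
      by (rule two_legs_of_light[OF _ _ _ light deg])
        (use p fi fj hi in \<open>auto simp: card_le_7 farD hub3_def edge_neq\<close>)
  qed (use p fi fj hi hj w iz wj ij in \<open>auto simp: hub3_def farD dest: edge_sym\<close>)
qed

text \<open>The tail is \<open>x, i, z i, w i, t i, p, t j\<close>.\<close>

lemma embeds_T9_of_hub4:
  assumes p: "far p" and light: "\<And>q. far q \<Longrightarrow> card (nb2 q) \<le> h"
    and light3: "\<And>q. far q \<Longrightarrow> card (nb3 q) \<le> h'" and card: "card (nb4 p) > 10 * h'"
    and deg: "card {y. E x y} > 7 * h + 16"
  shows "embeds (T_graph 9)"
proof -
  obtain z w t where hub: "\<And>y. y \<in> nb4 p \<Longrightarrow> hub4 p y (z y) (w y) (t y)"
    using nb4_choice by metis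
  obtain J where J: "J \<subseteq> nb4 p" "card J > 10" "inj_on t J"
    using hub4_inj[OF light3 finite_nb(3) card hub] by metis
  define K where "K = {y\<in>J. \<not> E p y}"
  have J_fin: "finite J"
    using finite_subset[OF J(1)] by simp
  have drop: "card {y\<in>J. E p y} \<le> 1"
    by (rule card_nbrs_le[OF J_fin p]) (use J hub in \<open>auto simp: hub4_def\<close>)
  have K: "card K \<ge> 10" "finite K" "K \<subseteq> nb4 p"
    unfolding K_def using J J_fin card_remove_ge[OF J_fin drop, of 10] by auto
  have zp: "z y \<noteq> p" if "y \<in> K" for y
    using that K hub no_triangle edge_sym unfolding hub4_def by blast
  define R where "R i j \<longleftrightarrow> E (z i) (t j) \<or> E (t i) j" for i j
  have out: "card {j\<in>K. R i j} \<le> 1 + 1" if i: "i \<in> K" for i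
    unfolding R_def
  proof (intro card_Collect_disj_le card_le_1I)
    fix j k assume jk: "j \<in> {j\<in>K. E (z i) (t j)}" "k \<in> {j\<in>K. E (z i) (t j)}"
    then have "E p (t j)" "E p (t k)"
      using K hub unfolding hub4_def by blast+
    then have "t j = t k"
      using common_nbr_unique[of "z i" "t j" "t k" p] jk zp[OF i] by blast
    then show "j = k"
      using J(3) jk unfolding K_def by (auto dest: inj_onD)
  next
    fix j k assume jk: "j \<in> {j\<in>K. E (t i) j}" "k \<in> {j\<in>K. E (t i) j}"
    then have "E x j" "E x k"
      using K hub unfolding hub4_def by blast+
    moreover have "t i \<noteq> x"
      using i K hub hub4_far(3) farD(1) by blast
    ultimately show "j = k"
      using parent_unique[of j k "t i"] jk by blast
  qed (use K in auto)
  obtain i j where ij: "i \<in> K" "j \<in> K" "i \<noteq> j" "\<not> R i j" "\<not> R j i"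
    by (rule independent_pair[where R = R, OF K(2) out]) (use K in auto)
  have hi: "hub4 p i (z i) (w i) (t i)" and hj: "hub4 p j (z j) (w j) (t j)"
    using ij K hub by auto
  have fi: "far (z i)" "far (w i)" "far (t i)" and fj: "far (t j)"
    using hub4_far[OF hi] hub4_far[OF hj] by auto
  have t: "t i \<noteq> t j"
    using J(3) ij unfolding K_def by (auto dest: inj_onD)
  have np: "\<not> E i p"
    using ij edge_sym unfolding K_def by blast
  show ?thesis
  proof (rule embeds_T9_centre[of i "z i" "w i" "t i" p "t j"])
    show "two_legs {i, z i, w i, t i, p, t j}"
      by (rule two_legs_of_light[OF _ _ _ light deg])
        (use p fi fj hi in \<open>auto simp: card_le_7 farD hub4_def edge_neq\<close>)
  qed (use p fi fj hi hj t np ij in \<open>auto simp: hub4_def farD R_def dest: edge_sym\<close>)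
qed

text \<open>The tail is \<open>x, i, z i, w i, p, w j\<close>, with a second child \<open>b i\<close> of \<open>i\<close> as \<open>w\<^sub>4\<close>.\<close>

lemma embeds_T8_2_of_hub3:
  assumes p: "far p" and light: "\<And>q. far q \<Longrightarrow> card (nb2 q) \<le> h" and card: "card (nb3 p) > (10 + h) * h"
    and deg: "card {y. E x y} > 7 * h + 16"
  shows "embeds T8_2"
proof -
  obtain J z w where J: "finite J" "card J > 10 + h" "inj_on w J" and hub: "\<And>y. y \<in> J \<Longrightarrow> hub3 p y (z y) (w y)"
    using hub3_inj[OF light card] by metis
  note far = hub3_far[OF hub]
  have "\<exists>b. E y b \<and> b \<noteq> x \<and> b \<noteq> z y" if "y \<in> J" for y
    using hub[OF that] child_exists[of y "z y"] unfolding hub3_def by blast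
  then obtain b where b: "\<And>y. y \<in> J \<Longrightarrow> E y (b y) \<and> b y \<noteq> x \<and> b y \<noteq> z y"
    by metis
  have b_far: "far (b y)" if "y \<in> J" for y
    using b[OF that] hub[OF that] child_far unfolding hub3_def by blast
  define K where "K = {y\<in>J. \<not> (E p (b y) \<or> E p y)}"
  have drop: "card {y\<in>J. E p (b y) \<or> E p y} \<le> h + 1"
  proof (rule card_Collect_disj_le)
    have "{y\<in>J. E p (b y)} \<subseteq> nb2 p"
      using b hub unfolding nb2_def hub3_def by blast
    then show "card {y\<in>J. E p (b y)} \<le> h"
      using light[OF p] card_mono[OF finite_nb(1)] le_trans by blast
    show "card {y\<in>J. E p y} \<le> 1"
      by (rule card_nbrs_le[OF J(1) p]) (use hub in \<open>auto simp: hub3_def\<close>)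
  qed
  have K: "card K \<ge> 10" "finite K" "K \<subseteq> J"
    using card_remove_ge[OF J(1) drop, of 10] J(1,2) by (auto simp: K_def)
  have bp: "b y \<noteq> p" if "y \<in> K" for y
    using that b edge_sym unfolding K_def by blast
  define R where "R i j \<longleftrightarrow> E (b i) (w j) \<or> E (w i) j" for i j
  have out: "card {j\<in>K. R i j} \<le> 1 + 1" if i: "i \<in> K" for i
    unfolding R_def
  proof (intro card_Collect_disj_le card_le_1I)
    fix j k assume jk: "j \<in> {j\<in>K. E (b i) (w j)}" "k \<in> {j\<in>K. E (b i) (w j)}"
    then have "E p (w j)" "E p (w k)"
      using K hub unfolding hub3_def by blast+
    then have "w j = w k"
      using common_nbr_unique[of "b i" "w j" "w k" p] jk bp[OF i] by blast
    then show "j = k"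
      using J(3) jk unfolding K_def by (auto dest: inj_onD)
  next
    fix j k assume jk: "j \<in> {j\<in>K. E (w i) j}" "k \<in> {j\<in>K. E (w i) j}"
    then have "E x j" "E x k"
      using K hub unfolding hub3_def by blast+
    moreover have "w i \<noteq> x"
      using i K far(2) farD(1) by blast
    ultimately show "j = k"
      using parent_unique[of j k "w i"] jk by blast
  qed (use K in auto)
  obtain i j where ij: "i \<in> K" "j \<in> K" "i \<noteq> j" "\<not> R i j" "\<not> R j i"
    by (rule independent_pair[where R = R, OF K(2) out]) (use K in auto)
  have J': "i \<in> J" "j \<in> J" "\<not> E p (b i)"
    using ij K unfolding K_def by auto
  have w: "w i \<noteq> w j"
    using J(3) J' ij by (auto dest: inj_onD)
  note hi = hub[OF J'(1)] and hj = hub[OF J'(2)] and fi = far[OF J'(1)] and fj = far[OF J'(2)]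
    and bi = b[OF J'(1)] b_far[OF J'(1)]
  show ?thesis
  proof (rule embeds_T8_2_centre[of i "z i" "w i" p "w j" "b i"])
    show "two_legs {i, z i, w i, p, w j, b i}"
      by (rule two_legs_of_light[OF _ _ _ light deg])
        (use p fi fj hi bi in \<open>auto simp: card_le_7 farD hub3_def edge_neq\<close>)
  qed (use p fi fj hi hj bi w ij J' in \<open>auto simp: hub3_def farD R_def dest: edge_sym\<close>)
qed

text \<open>
  Here a single path suffices: the tail is \<open>x, y, z, w, t, p\<close>, with a second child \<open>b\<close> of \<open>y\<close> as \<open>w\<^sub>4\<close>. An
  edge from \<open>b\<close> to \<open>t\<close> or \<open>p\<close> would put \<open>y\<close> into \<open>nb3 p\<close> or \<open>nb2 p\<close>.
\<close>

lemma embeds_T8_2_of_hub4: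
  assumes p: "far p" and light: "\<And>q. far q \<Longrightarrow> card (nb2 q) \<le> h"
    and light3: "\<And>q. far q \<Longrightarrow> card (nb3 q) \<le> h'" and card: "card (nb4 p) > h + h' + 1"
    and deg: "card {y. E x y} > 7 * h + 16"
  shows "embeds T8_2"
proof -
  have "card {y. E x y \<and> E p y} \<le> 1"
    using parent_unique[of _ _ p] farD(1)[OF p]
    by (intro card_le_1I) (auto intro: rev_finite_subset[OF finite_edge[of x]])
  then have "card (nb2 p \<union> nb3 p \<union> {y. E x y \<and> E p y}) \<le> h + h' + 1"
    using light[OF p] light3[OF p] by (meson add_mono card_Un_le le_trans)
  then have "\<not> nb4 p \<subseteq> nb2 p \<union> nb3 p \<union> {y. E x y \<and> E p y}"
    using card card_mono[of "nb2 p \<union> nb3 p \<union> {y. E x y \<and> E p y}" "nb4 p"] 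
    by (auto intro: rev_finite_subset[OF finite_edge[of x]])
  then obtain y z w t where y: "hub4 p y z w t" "y \<notin> nb2 p" "y \<notin> nb3 p" "\<not> E p y"
    unfolding nb4_def hub4_def by auto
  obtain b where b: "E y b" "b \<noteq> x" "b \<noteq> z"
    using y(1) child_exists[of y z] unfolding hub4_def by blast
  have "far b"
    using b y child_far unfolding hub4_def by blast
  have bp: "\<not> E p b"
    using y b unfolding nb2_def hub4_def by blast
  have "p \<noteq> b"
    using y b edge_sym by blast
  moreover have "t \<noteq> y"
    using hub4_far[OF y(1)] y(1) unfolding hub4_def far_def by blast
  ultimately have bt: "\<not> E b t"
    using y b unfolding nb3_def hub3_def hub4_def by blast
  note far = hub4_far[OF y(1)]
  show ?thesis
  proof (rule embeds_T8_2_centre[of y z w t p b])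
    show "two_legs {y, z, w, t, p, b}"
      by (rule two_legs_of_light[OF _ _ _ light deg])
        (use p far \<open>far b\<close> y(1) in \<open>auto simp: card_le_7 farD hub4_def edge_neq\<close>)
  qed (use p far \<open>far b\<close> y b bp bt in \<open>auto simp: hub4_def farD dest: edge_sym\<close>)
qed

text \<open>
  The tail is \<open>x, i, z i, w i, p, w j\<close>, with further neighbours of \<open>z i\<close> and \<open>w i\<close> as \<open>w\<^sub>5\<close> and \<open>w\<^sub>6\<close>. The
  latter must be far from \<open>x\<close>, so the \<open>i\<close> for which \<open>w i\<close> is at distance two from \<open>x\<close> are discarded.
\<close>

lemma embeds_T8_1_of_hub3:
  assumes p: "far p" and light: "\<And>q. far q \<Longrightarrow> card (nb2 q) \<le> h" and card: "card (nb3 p) > (5 + h) * h"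
    and deg: "card {y. E x y} > 7 * h + 16"
  shows "embeds T8_1"
proof -
  obtain J z w where J: "finite J" "card J > 5 + h" "inj_on w J" and hub: "\<And>y. y \<in> J \<Longrightarrow> hub3 p y (z y) (w y)"
    using hub3_inj[OF light card] by metis
  note far = hub3_far[OF hub]
  define K where "K = {y\<in>J. \<not> (\<exists>g. E x g \<and> E (w y) g)}"
  have drop: "card {y\<in>J. \<exists>g. E x g \<and> E (w y) g} \<le> h"
    using card_with_parent_le[OF J(1) p J(3)] far hub light[OF p] unfolding hub3_def by (meson le_trans)
  have K: "card K \<ge> 6" "finite K" "K \<subseteq> J"
    using card_remove_ge[OF J(1) drop, of 6] J(1,2) by (auto simp: K_def)
  have "\<exists>e. E (z y) e \<and> e \<noteq> y \<and> e \<noteq> w y" if "y \<in> J" for y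
    using hub[OF that] third_nbr[of "z y" y "w y"] edge_in_V unfolding hub3_def by blast
  then obtain e where e: "\<And>y. y \<in> J \<Longrightarrow> E (z y) (e y) \<and> e y \<noteq> y \<and> e y \<noteq> w y"
    by metis
  have e_far: "far (e y)" if "y \<in> J" for y
    using e[OF that] hub[OF that] grandchild_far unfolding hub3_def by blast
  have ep: "e y \<noteq> p" if "y \<in> J" for y
    using e[OF that] hub[OF that] no_triangle edge_sym unfolding hub3_def by blast
  have out: "card {j\<in>K. E (e i) (w j)} \<le> 1" if i: "i \<in> K" for i
  proof (rule card_le_1I)
    fix j k assume jk: "j \<in> {j\<in>K. E (e i) (w j)}" "k \<in> {j\<in>K. E (e i) (w j)}"
    then have "E p (w j)" "E p (w k)"
      using K hub unfolding hub3_def by blast+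
    then have "w j = w k"
      using common_nbr_unique[of "e i" "w j" "w k" p] jk ep i K by blast
    then show "j = k"
      using J(3) jk unfolding K_def by (auto dest: inj_onD)
  qed (use K in auto)
  obtain i j where ij: "i \<in> K" "j \<in> K" "i \<noteq> j" "\<not> E (e i) (w j)"
    by (rule independent_pair[where R = "\<lambda>i j. E (e i) (w j)", OF K(2) out]) (use K in auto)
  have J': "i \<in> J" "j \<in> J"
    using ij K by auto
  have w: "w i \<noteq> w j"
    using J(3) J' ij by (auto dest: inj_onD)
  note hi = hub[OF J'(1)] and hj = hub[OF J'(2)] and fi = far[OF J'(1)] and fj = far[OF J'(2)]
    and ei = e[OF J'(1)] e_far[OF J'(1)]
  obtain f where f: "E (w i) f" "f \<noteq> z i" "f \<noteq> p"
    using third_nbr[of "w i" "z i" p] hi edge_in_V2 unfolding hub3_def by blast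
  have f_far: "far f"
    using f ij(1) fi farD edge_sym unfolding K_def far_def by blast
  have yw: "\<not> E i (w j)"
    using ij(2) hi edge_sym unfolding K_def hub3_def by blast
  show ?thesis
  proof (rule embeds_T8_1_centre[of i "z i" "w i" p "w j" "e i" f])
    show "two_legs {i, z i, w i, p, w j, e i, f}"
      by (rule two_legs_of_light[OF _ _ _ light deg])
        (use p fi fj hi ei f_far in \<open>auto simp: card_le_7 farD hub3_def edge_neq\<close>)
  qed (use p fi fj hi hj ei f f_far w ij yw in \<open>auto simp: hub3_def farD dest: edge_sym\<close>)
qed

text \<open>
  If some \<open>w y\<close> has a far neighbour \<open>f\<close> off the path \<open>y, z y, w y, t y, p\<close>, this path is a tail, with \<open>f\<close> as
  \<open>w\<^sub>6\<close> and a further neighbour \<open>e\<close> of \<open>z y\<close> as \<open>w\<^sub>5\<close>. Otherwise each \<open>w i\<close> is a child of some \<open>g i\<close>, and the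
  shorter way \<open>x, g i, w i, t i, p, t j\<close> is a tail, with \<open>z i\<close> as \<open>w\<^sub>5\<close> and a further neighbour of \<open>t i\<close> as \<open>w\<^sub>6\<close>.
\<close>

lemma embeds_T8_1_of_hub4:
  assumes p: "far p" and light: "\<And>q. far q \<Longrightarrow> card (nb2 q) \<le> h"
    and light3: "\<And>q. far q \<Longrightarrow> card (nb3 q) \<le> h'" and card: "card (nb4 p) > (5 + h) * h' + h' + 1"
    and deg: "card {y. E x y} > 7 * h + 16"
  shows "embeds T8_1"
proof -
  define I where "I = {y\<in>nb4 p. \<not> (y \<in> nb3 p \<or> E p y)}"
  have drop: "card {y\<in>nb4 p. y \<in> nb3 p \<or> E p y} \<le> h' + 1"
  proof (rule card_Collect_disj_le)
    have "card {y \<in> nb4 p. y \<in> nb3 p} \<le> card (nb3 p)"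
      by (rule card_mono) auto
    then show "card {y \<in> nb4 p. y \<in> nb3 p} \<le> h'"
      using light3[OF p] by simp
    show "card {y\<in>nb4 p. E p y} \<le> 1"
      by (rule card_nbrs_le[OF finite_nb(3) p]) (auto simp: nb4_def hub4_def)
  qed
  have I: "card I > (5 + h) * h'" "finite I"
    using card_remove_ge[OF finite_nb(3) drop, of "(5 + h) * h' + 1"] card by (auto simp: I_def)
  obtain z w t where "\<And>y. y \<in> nb4 p \<Longrightarrow> hub4 p y (z y) (w y) (t y)"
    using nb4_choice by metis
  then have hub: "hub4 p y (z y) (w y) (t y)" if "y \<in> I" for y
    using that unfolding I_def by simp
  note far = hub4_far[OF hub]
  show ?thesis
  proof (cases "\<exists>y\<in>I. \<exists>f. E (w y) f \<and> f \<noteq> z y \<and> f \<noteq> t y \<and> far f")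
    case True
    then obtain y f where y: "y \<in> I" and f: "E (w y) f" "f \<noteq> z y" "f \<noteq> t y" "far f"
      by blast
    obtain e where e: "E (z y) e" "e \<noteq> y" "e \<noteq> w y"
      using third_nbr[of "z y" y "w y"] hub[OF y] edge_in_V unfolding hub4_def by blast
    have e_far: "far e"
      using e hub[OF y] grandchild_far unfolding hub4_def by blast
    have "p \<noteq> z y"
      using hub[OF y] no_triangle edge_sym unfolding hub4_def by blast
    then have ep: "\<not> E p e"
      using y e hub[OF y] unfolding I_def nb3_def hub3_def hub4_def by blast
    have yp: "\<not> E y p"
      using y edge_sym unfolding I_def by blast
    show ?thesis
    proof (rule embeds_T8_1_centre[of y "z y" "w y" "t y" p e f])
      show "two_legs {y, z y, w y, t y, p, e, f}"
        by (rule two_legs_of_light[OF _ _ _ light deg])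
          (use p far[OF y] hub[OF y] e_far f in \<open>auto simp: card_le_7 farD hub4_def edge_neq\<close>)
    qed (use p far[OF y] hub[OF y] e e_far f ep yp in \<open>auto simp: hub4_def farD dest: edge_sym\<close>)
  next
    case False
    have "\<exists>g. E x g \<and> E (w y) g" if y: "y \<in> I" for y
    proof -
      obtain f where "E (w y) f" "f \<noteq> z y" "f \<noteq> t y"
        using third_nbr[of "w y" "z y" "t y"] hub[OF y] edge_in_V unfolding hub4_def by blast
      moreover have "f \<noteq> x"
        using \<open>E (w y) f\<close> farD(4)[OF far(2)[OF y]] by blast
      ultimately show ?thesis
        using False y unfolding far_def by blast
    qed
    then obtain g where g: "\<And>y. y \<in> I \<Longrightarrow> E x (g y) \<and> E (w y) (g y)"
      by metis
    obtain J where J: "J \<subseteq> I" "card J > 5 + h" "inj_on t J"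
      using hub4_inj[OF light3 I(2,1) hub] by metis
    have J_fin: "finite J"
      using finite_subset[OF J(1) I(2)] .
    define K where "K = {y\<in>J. \<not> (\<exists>g. E x g \<and> E (t y) g)}"
    have drop: "card {y\<in>J. \<exists>g. E x g \<and> E (t y) g} \<le> card (nb2 p)"
      by (rule card_with_parent_le[OF J_fin p J(3)]) (use J(1) far hub in \<open>auto simp: hub4_def\<close>)
    have K: "card K \<ge> 6" "finite K" "K \<subseteq> J"
      using card_remove_ge[OF J_fin drop, of 6] J(2) J_fin light[OF p] by (auto simp: K_def)
    have out: "card {j\<in>K. E (z i) (t j)} \<le> 1" if i: "i \<in> K" for i
    proof (rule card_le_1I)
      fix j k assume jk: "j \<in> {j\<in>K. E (z i) (t j)}" "k \<in> {j\<in>K. E (z i) (t j)}"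
      then have "E p (t j)" "E p (t k)"
        using K J hub unfolding hub4_def by blast+
      moreover have "z i \<noteq> p"
        using hub[of i] i K J no_triangle edge_sym unfolding hub4_def by blast
      ultimately have "t j = t k"
        using common_nbr_unique[of "z i" "t j" "t k" p] jk by blast
      then show "j = k"
        using J(3) jk unfolding K_def by (auto dest: inj_onD)
    qed (use K in auto)
    obtain i j where ij: "i \<in> K" "j \<in> K" "i \<noteq> j" "\<not> E (z i) (t j)"
      by (rule independent_pair[where R = "\<lambda>i j. E (z i) (t j)", OF K(2) out]) (use K in auto)
    have ijI: "i \<in> I" "j \<in> I"
      using ij K J by auto
    have t: "t i \<noteq> t j"
      using J(3) ij K by (auto dest: inj_onD)
    note hi = hub[OF ijI(1)] and hj = hub[OF ijI(2)] and fi = far[OF ijI(1)] and fj = far[OF ijI(2)]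
      and gi = g[OF ijI(1)]
    obtain f where f: "E (t i) f" "f \<noteq> w i" "f \<noteq> p"
      using third_nbr[of "t i" "w i" p] hi edge_in_V2 unfolding hub4_def by blast
    have f_far: "far f"
      using f ij(1) fi farD edge_sym unfolding K_def far_def by blast
    have gt: "\<not> E (g i) (t j)"
      using ij(2) gi edge_sym unfolding K_def by blast
    have gz: "g i \<noteq> z i" "g i \<noteq> t i" "g i \<noteq> x" "g i \<noteq> f"
      using gi fi f_far edge_neq unfolding far_def by auto
    show ?thesis
    proof (rule embeds_T8_1_centre[of "g i" "w i" "t i" p "t j" "z i" f])
      show "two_legs {g i, w i, t i, p, t j, z i, f}"
        by (rule two_legs_of_light[OF _ _ _ light deg])
          (use p fi fj f_far gz in \<open>auto simp: card_le_7 farD\<close>)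
    qed (use p fi fj hi hj gi f f_far t ij gt gz in \<open>auto simp: hub4_def farD dest: edge_sym\<close>)
  qed
qed

end

section \<open>Graphs without hubs\<close>

context rooted_girth5_graph
begin

text \<open>
  A branch at the neighbour \<open>y\<close> of \<open>x\<close> consists of two children \<open>z\<close>, \<open>z'\<close> of \<open>y\<close>, two paths \<open>z, n1, k1\<close>
  and \<open>z, n2, k2\<close> that stay far from \<open>x\<close>, and a neighbour \<open>m\<close> of \<open>z'\<close>. Since \<open>z\<close> is the only common
  neighbour of \<open>n1\<close> and \<open>n2\<close>, their roles can be chosen such that \<open>n1\<close> is not adjacent to \<open>m\<close>. Which of
  \<open>k1\<close>, \<open>k2\<close>, \<open>z'\<close> are adjacent is left open and decides between the constructions below.
\<close>

definition branch :: "'a \<Rightarrow> 'a \<Rightarrow> 'a \<Rightarrow> 'a \<Rightarrow> 'a \<Rightarrow> 'a \<Rightarrow> 'a \<Rightarrow> 'a \<Rightarrow> bool" where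
  "branch y z z' n1 n2 k1 k2 m \<longleftrightarrow> E x y \<and> E y z \<and> E y z' \<and> z \<noteq> z' \<and> z \<noteq> x \<and> z' \<noteq> x
     \<and> E z n1 \<and> E z n2 \<and> n1 \<noteq> n2 \<and> n1 \<noteq> y \<and> n2 \<noteq> y
     \<and> E n1 k1 \<and> E n2 k2 \<and> k1 \<noteq> z \<and> k2 \<noteq> z \<and> far k1 \<and> far k2
     \<and> E z' m \<and> m \<noteq> y \<and> \<not> E n1 m"

lemma branch_exists:
  assumes "E x y"
  obtains z z' n1 n2 k1 k2 m where "branch y z z' n1 n2 k1 k2 m"
proof -
  obtain z where z: "E y z" "z \<noteq> x"
    using child_exists assms by blast
  obtain z' where z': "E y z'" "z' \<noteq> x" "z' \<noteq> z"
    using child_exists assms by blast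
  obtain m where m: "E z' m" "m \<noteq> y"
    using third_nbr[of z' y y] z' edge_in_V2 by blast
  obtain n where n: "E z n" "n \<noteq> y"
    using third_nbr[of z y y] z edge_in_V2 by blast
  obtain n' where n': "E z n'" "n' \<noteq> y" "n' \<noteq> n"
    using third_nbr[of z y n] z edge_in_V2 by blast
  have "z \<noteq> m"
    using no_triangle[OF z'(1) m(1)] z(1) by blast
  then have "\<not> E n m \<or> \<not> E n' m"
    using common_nbr_unique[of z n n' m] n n' edge_sym by blast
  then obtain n1 n2 where n12: "E z n1" "n1 \<noteq> y" "E z n2" "n2 \<noteq> y" "n1 \<noteq> n2" "\<not> E n1 m"
    using n n' by metis
  have "far n1" "far n2"
    using grandchild_far[OF assms z] n12 by blast+
  moreover have "n1 \<in> V" "n2 \<in> V"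
    using n12 edge_in_V2 by blast+
  ultimately obtain k1 k2 where k: "E n1 k1" "k1 \<noteq> z" "far k1" "E n2 k2" "k2 \<noteq> z" "far k2"
    using far_nbr_exists by metis
  have "branch y z z' n1 n2 k1 k2 m"
    unfolding branch_def using z z' m n12 k assms by simp
  then show thesis
    by (rule that)
qed

lemma branch_far:
  assumes "branch y z z' n1 n2 k1 k2 m"
  shows "far z" "far z'" "far n1" "far n2" "far k1" "far k2" "far m"
  using assms child_far grandchild_far unfolding branch_def by blast+

text \<open>
  A far vertex \<open>p\<close> adjacent to the vertex \<open>v\<close> of a branch is joined to \<open>y\<close> by a path through \<open>v\<close>, except
  that if \<open>p\<close> is itself the vertex of the branch before \<open>v\<close>, the path has to be cut short there.
\<close>

lemma branch_nb:
  assumes b: "branch y z z' n1 n2 k1 k2 m" and "far p" and v: "v \<in> {z, z', n1, n2, k1, k2, m}" and p: "E p v"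
  shows "E p y \<or> y \<in> nb2 p \<or> y \<in> nb3 p \<or> y \<in> nb4 p"
proof -
  have level2: "E p y \<or> y \<in> nb2 p" if "E x y" "E y u" "u \<noteq> x" "E p u \<or> p = u" for u
    using that edge_sym unfolding nb2_def by blast
  have level3: "E p y \<or> y \<in> nb2 p \<or> y \<in> nb3 p"
    if "E x y" "E y u" "u \<noteq> x" "E u w" "w \<noteq> y" "E p w \<or> p = w" for u w
    using that level2[of u] edge_sym unfolding nb3_def hub3_def by blast
  have level4: "E p y \<or> y \<in> nb2 p \<or> y \<in> nb3 p \<or> y \<in> nb4 p"
    if "E x y" "E y u" "u \<noteq> x" "E u w" "w \<noteq> y" "E w t" "t \<noteq> u" "far t" "E p t" for u w t
    using that level3[of u w] unfolding nb4_def hub4_def by blast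
  consider "v = z" | "v = z'" | "v = n1" | "v = n2" | "v = m" | "v = k1" | "v = k2"
    using v by blast
  then show ?thesis
  proof cases
    case 1 then show ?thesis using level2[of z] b p unfolding branch_def by blast
  next
    case 2 then show ?thesis using level2[of z'] b p unfolding branch_def by blast
  next
    case 3 then show ?thesis using level3[of z n1] b p unfolding branch_def by blast
  next
    case 4 then show ?thesis using level3[of z n2] b p unfolding branch_def by blast
  next
    case 5 then show ?thesis using level3[of z' m] b p unfolding branch_def by blast
  next
    case 6 then show ?thesis using level4[of z n1 k1] b p unfolding branch_def by blast
  next
    case 7 then show ?thesis using level4[of z n2 k2] b p unfolding branch_def by blast
  qed
qed

text \<open>The extra neighbour \<open>y''\<close> of \<open>x\<close> serves as a pendant vertex at \<open>x\<close>.\<close>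

lemma two_anticomplete_branches:
  assumes light: "\<And>q. far q \<Longrightarrow> card (nb2 q) \<le> h2" "\<And>q. far q \<Longrightarrow> card (nb3 q) \<le> h3"
      "\<And>q. far q \<Longrightarrow> card (nb4 q) \<le> h4"
    and deg: "card {y. E x y} \<ge> 28 * (1 + h2 + h3 + h4) + 2"
  obtains y z z' n1 n2 k1 k2 m Y Z Z' N1 N2 K1 K2 M y'' where
    "branch y z z' n1 n2 k1 k2 m" "branch Y Z Z' N1 N2 K1 K2 M" "y \<noteq> Y"
    "\<forall>u\<in>{y, z, z', n1, n2, k1, k2, m}. \<forall>v\<in>{Y, Z, Z', N1, N2, K1, K2, M}. \<not> E u v"
    "E x y''" "\<forall>u\<in>{y, z, z', n1, n2, k1, k2, m, Y, Z, Z', N1, N2, K1, K2, M}. \<not> E u y''"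
    "y'' \<noteq> y" "y'' \<noteq> Y"
proof -
  define br where "br y S \<longleftrightarrow> (\<exists>z z' n1 n2 k1 k2 m. branch y z z' n1 n2 k1 k2 m \<and> S = {z, z', n1, n2, k1, k2, m})"
    for y S
  have "\<exists>S. br y S" if "E x y" for y
    using branch_exists[OF that] unfolding br_def by metis
  then obtain S where S: "\<And>y. E x y \<Longrightarrow> br y (S y)"
    by metis
  have S_far: "far u" if yu: "E x y" "u \<in> S y" for y u
  proof -
    obtain z z' n1 n2 k1 k2 m where "branch y z z' n1 n2 k1 k2 m" "S y = {z, z', n1, n2, k1, k2, m}"
      using S[OF yu(1)] unfolding br_def by blast
    then show ?thesis
      using branch_far[of y z z' n1 n2 k1 k2 m] yu(2) by auto
  qed
  have S_card: "finite (S y)" "card (S y) \<le> 7" if y: "E x y" for y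
  proof -
    obtain z z' n1 n2 k1 k2 m where "S y = {z, z', n1, n2, k1, k2, m}"
      using S[OF y] unfolding br_def by blast
    then show "finite (S y)" "card (S y) \<le> 7"
      by (simp_all only: card_le_7 finite.emptyI finite_insert)
  qed
  have S_nb: "E p y \<or> y \<in> nb2 p \<or> y \<in> nb3 p \<or> y \<in> nb4 p" if u: "E x y" "far p" "u \<in> S y" "E p u" for p y u
  proof -
    obtain z z' n1 n2 k1 k2 m where b: "branch y z z' n1 n2 k1 k2 m" "S y = {z, z', n1, n2, k1, k2, m}"
      using S[OF u(1)] unfolding br_def by blast
    show ?thesis
      using branch_nb[OF b(1) u(2) _ u(4)] u(3) unfolding b(2) .
  qed
  let ?A = "{y. E x y}"
  \<comment> \<open>The clause \<open>E p Y\<close> is directed: a branch is adjacent to few \<open>Y\<close>, but \<open>Y\<close> may meet many branches.\<close>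
  define R where "R y Y \<longleftrightarrow> (\<exists>p\<in>S y. E p Y \<or> (\<exists>u\<in>S Y. E p u))" for y Y
  have out: "card {Y\<in>?A. R y Y} \<le> 7 * (1 + h2 + h3 + h4)" if y: "y \<in> ?A" for y
  proof -
    let ?N = "\<lambda>p. {Y\<in>?A. E p Y} \<union> nb2 p \<union> nb3 p \<union> nb4 p"
    have fin: "finite (\<Union>p\<in>S y. ?N p)"
      using S_card y by auto
    have "{Y\<in>?A. R y Y} \<subseteq> (\<Union>p\<in>S y. ?N p)"
    proof
      fix Y assume Y: "Y \<in> {Y\<in>?A. R y Y}"
      then obtain p where p: "p \<in> S y" "E p Y \<or> (\<exists>u\<in>S Y. E p u)"
        unfolding R_def by blast
      have "far p"
        using S_far p y by simp
      then have "E p Y \<or> Y \<in> nb2 p \<or> Y \<in> nb3 p \<or> Y \<in> nb4 p"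
        using p Y S_nb[of Y p] by auto
      then show "Y \<in> (\<Union>p\<in>S y. ?N p)"
        using p(1) Y by auto
    qed
    then have "card {Y\<in>?A. R y Y} \<le> card (\<Union>p\<in>S y. ?N p)"
      by (rule card_mono[OF fin])
    also have "\<dots> \<le> card (S y) * (1 + h2 + h3 + h4)"
    proof (rule card_Union_le_mult)
      fix p assume "p \<in> S y"
      then have p: "far p"
        using S_far y by simp
      have "card {Y\<in>?A. E p Y} \<le> 1"
        by (rule card_nbrs_le[OF _ p]) auto
      then show "card (?N p) \<le> 1 + h2 + h3 + h4"
        using light[OF p] by (meson add_mono card_Un_le le_trans)
    qed (use S_card y in simp)
    also have "\<dots> \<le> 7 * (1 + h2 + h3 + h4)"
      using S_card(2)[of y] y by (intro mult_le_mono1) simp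
    finally show ?thesis .
  qed
  obtain y Y where yY: "y \<in> ?A" "Y \<in> ?A" "y \<noteq> Y" "\<not> R y Y" "\<not> R Y y"
    by (rule independent_pair[where R = R, OF finite_edge out]) (use deg in auto)
  let ?P = "S y \<union> S Y"
  have "card ?P \<le> 14"
    using S_card[of y] S_card[of Y] yY card_Un_le[of "S y" "S Y"] by simp
  moreover have "x \<notin> ?P"
    using S_far yY farD(1) by blast
  ultimately have "card {y. E x y \<and> (\<exists>p\<in>?P. E p y)} \<le> 14"
    using card_covered_le[of ?P] S_card yY by (simp add: le_trans)
  moreover have "card {y, Y} \<le> 2"
    by (simp add: card_insert_if)
  ultimately have "card ({y. E x y \<and> (\<exists>p\<in>?P. E p y)} \<union> {y, Y}) \<le> 16"
    using card_Un_le[of "{y. E x y \<and> (\<exists>p\<in>?P. E p y)}" "{y, Y}"] by linarith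
  then have "\<not> ?A \<subseteq> {y. E x y \<and> (\<exists>p\<in>?P. E p y)} \<union> {y, Y}"
    using deg card_mono[of "{y. E x y \<and> (\<exists>p\<in>?P. E p y)} \<union> {y, Y}" ?A]
    by (auto intro: rev_finite_subset[OF finite_edge[of x]])
  then obtain y'' where y'': "E x y''" "\<forall>p\<in>?P. \<not> E p y''" "y'' \<noteq> y" "y'' \<noteq> Y"
    by blast
  obtain z z' n1 n2 k1 k2 m where b: "branch y z z' n1 n2 k1 k2 m" "S y = {z, z', n1, n2, k1, k2, m}"
    using S[of y] yY(1) unfolding br_def by auto
  obtain Z Z' N1 N2 K1 K2 M where B: "branch Y Z Z' N1 N2 K1 K2 M" "S Y = {Z, Z', N1, N2, K1, K2, M}"
    using S[of Y] yY(2) unfolding br_def by auto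
  have top: "\<not> E y Y" "\<not> E y y''" "\<not> E Y y''"
    using yY y''(1) no_triangle by blast+
  have apart: "\<not> E u v" if "u \<in> insert y (S y)" "v \<in> insert Y (S Y)" for u v
    using that yY(4,5) top(1) edge_sym unfolding R_def by blast
  have apart'': "\<not> E u y''" if "u \<in> insert y (S y) \<union> insert Y (S Y)" for u
    using that y''(2) top by blast
  show thesis
  proof (rule that[OF b(1) B(1) yY(3)])
    show "\<forall>u\<in>{y, z, z', n1, n2, k1, k2, m}. \<forall>v\<in>{Y, Z, Z', N1, N2, K1, K2, M}. \<not> E u v"
      using apart unfolding b(2) B(2) by blast
    show "\<forall>u\<in>{y, z, z', n1, n2, k1, k2, m, Y, Z, Z', N1, N2, K1, K2, M}. \<not> E u y''"
      using apart'' unfolding b(2) B(2) by blast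
  qed (use y'' in auto)
qed

text \<open>
  If \<open>k1\<close> and \<open>k2\<close> are not adjacent, \<open>z\<close> is the centre \<open>u\<^sub>3\<close> and \<open>x = u\<^sub>5\<close>. If they are adjacent,
  \<open>x, y, z, n1, k1, k2\<close> is a tail of length five, for the centre \<open>Y\<close> and \<open>x = u\<^sub>4\<close>.
\<close>

lemma embeds_T9_of_light:
  assumes light: "\<And>q. far q \<Longrightarrow> card (nb2 q) \<le> h2" "\<And>q. far q \<Longrightarrow> card (nb3 q) \<le> h3"
      "\<And>q. far q \<Longrightarrow> card (nb4 q) \<le> h4"
    and deg: "card {y. E x y} \<ge> 28 * (1 + h2 + h3 + h4) + 2"
  shows "embeds (T_graph 9)"
proof -
  obtain y z z' n1 n2 k1 k2 m Y Z Z' N1 N2 K1 K2 M w where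
    b: "branch y z z' n1 n2 k1 k2 m" "branch Y Z Z' N1 N2 K1 K2 M" "y \<noteq> Y"
    and a: "\<forall>u\<in>{y, z, z', n1, n2, k1, k2, m}. \<forall>v\<in>{Y, Z, Z', N1, N2, K1, K2, M}. \<not> E u v"
    and w: "E x w" "\<forall>u\<in>{y, z, z', n1, n2, k1, k2, m, Y, Z, Z', N1, N2, K1, K2, M}. \<not> E u w" "w \<noteq> y" "w \<noteq> Y"
    by (rule two_anticomplete_branches[OF assms])
  have a': "\<forall>u\<in>{y, z, z', n1, n2, k1, k2, m}. \<forall>v\<in>{Y, Z, Z', N1, N2, K1, K2, M}. \<not> E v u"
    using a not_edge_sym by blast
  note far = branch_far[OF b(1)] branch_far[OF b(2)]
  show ?thesis
  proof (cases "E k1 k2")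
    case False
    show ?thesis
      by (rule embeds_T9I[of k1 n1 z y x Y Z N1 K1 n2 k2])
        (use b far a a' False in \<open>auto simp: branch_def farD dest: edge_sym\<close>)
  next
    case True
    have yk: "\<not> E y k2"
      using path3_not_edge[of y z n2 k2] b(1) unfolding branch_def by blast
    have nk: "n1 \<noteq> k2"
      using no_triangle[of z n1 n2] b(1) edge_sym unfolding branch_def by blast
    show ?thesis
      by (rule embeds_T9I[of N1 Z Y x y z n1 k1 k2 Z' M])
        (use b far a a' True yk nk in \<open>auto simp: branch_def farD dest: edge_sym\<close>)
  qed
qed

text \<open>The centre is \<open>y\<close>, and \<open>x = u\<^sub>4\<close>.\<close>

lemma embeds_T8_2_of_light:
  assumes light: "\<And>q. far q \<Longrightarrow> card (nb2 q) \<le> h2" "\<And>q. far q \<Longrightarrow> card (nb3 q) \<le> h3"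
      "\<And>q. far q \<Longrightarrow> card (nb4 q) \<le> h4"
    and deg: "card {y. E x y} \<ge> 28 * (1 + h2 + h3 + h4) + 2"
  shows "embeds T8_2"
proof -
  obtain y z z' n1 n2 k1 k2 m Y Z Z' N1 N2 K1 K2 M w where
    b: "branch y z z' n1 n2 k1 k2 m" "branch Y Z Z' N1 N2 K1 K2 M" "y \<noteq> Y"
    and a: "\<forall>u\<in>{y, z, z', n1, n2, k1, k2, m}. \<forall>v\<in>{Y, Z, Z', N1, N2, K1, K2, M}. \<not> E u v"
    and w: "E x w" "\<forall>u\<in>{y, z, z', n1, n2, k1, k2, m, Y, Z, Z', N1, N2, K1, K2, M}. \<not> E u w" "w \<noteq> y" "w \<noteq> Y"
    by (rule two_anticomplete_branches[OF assms])
  have a': "\<forall>u\<in>{y, z, z', n1, n2, k1, k2, m}. \<forall>v\<in>{Y, Z, Z', N1, N2, K1, K2, M}. \<not> E v u"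
    and w': "\<forall>u\<in>{y, z, z', n1, n2, k1, k2, m, Y, Z, Z', N1, N2, K1, K2, M}. \<not> E w u"
    using a w(2) not_edge_sym by blast+
  note far = branch_far[OF b(1)] branch_far[OF b(2)]
  show ?thesis
    by (rule embeds_T8_2I[of n1 z y x Y Z N1 K1 z' m w])
      (use b far a a' w w' in \<open>auto simp: branch_def farD dest: edge_sym\<close>)
qed

text \<open>
  Since \<open>k1, k2, z'\<close> is not a triangle, one of three pairs is non-adjacent. For \<open>k1\<close> and \<open>k2\<close> the centre
  is \<open>z\<close> and \<open>x = u\<^sub>5\<close>; otherwise the centre is \<open>Y\<close>, \<open>x = u\<^sub>4\<close>, and \<open>z'\<close> is the pendant vertex at \<open>u\<^sub>5 = y\<close>.
\<close>

lemma embeds_T8_1_of_light: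
  assumes light: "\<And>q. far q \<Longrightarrow> card (nb2 q) \<le> h2" "\<And>q. far q \<Longrightarrow> card (nb3 q) \<le> h3"
      "\<And>q. far q \<Longrightarrow> card (nb4 q) \<le> h4"
    and deg: "card {y. E x y} \<ge> 28 * (1 + h2 + h3 + h4) + 2"
  shows "embeds T8_1"
proof -
  obtain y z z' n1 n2 k1 k2 m Y Z Z' N1 N2 K1 K2 M w where
    b: "branch y z z' n1 n2 k1 k2 m" "branch Y Z Z' N1 N2 K1 K2 M" "y \<noteq> Y"
    and a: "\<forall>u\<in>{y, z, z', n1, n2, k1, k2, m}. \<forall>v\<in>{Y, Z, Z', N1, N2, K1, K2, M}. \<not> E u v"
    and w: "E x w" "\<forall>u\<in>{y, z, z', n1, n2, k1, k2, m, Y, Z, Z', N1, N2, K1, K2, M}. \<not> E u w" "w \<noteq> y" "w \<noteq> Y"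
    by (rule two_anticomplete_branches[OF assms])
  have a': "\<forall>u\<in>{y, z, z', n1, n2, k1, k2, m}. \<forall>v\<in>{Y, Z, Z', N1, N2, K1, K2, M}. \<not> E v u"
    and w': "\<forall>u\<in>{y, z, z', n1, n2, k1, k2, m, Y, Z, Z', N1, N2, K1, K2, M}. \<not> E w u"
    using a w(2) not_edge_sym by blast+
  note far = branch_far[OF b(1)] branch_far[OF b(2)]
  consider "\<not> E k1 k2" | "\<not> E z' k1" | "\<not> E z' k2"
    using no_triangle edge_sym by blast
  then show ?thesis
  proof cases
    case 1
    show ?thesis
      by (rule embeds_T8_1I[of k1 n1 z y x Y Z N1 n2 k2 w Z'])
        (use b far a a' w w' 1 1[THEN not_edge_sym] in \<open>auto simp: branch_def farD dest: edge_sym\<close>)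
  next
    case 2
    show ?thesis
      by (rule embeds_T8_1I[of N1 Z Y x y z n1 k1 Z' M z' n2])
        (use b far a a' 2 2[THEN not_edge_sym] in \<open>auto simp: branch_def farD dest: edge_sym\<close>)
  next
    case 3
    show ?thesis
      by (rule embeds_T8_1I[of N1 Z Y x y z n2 k2 Z' M z' n1])
        (use b far a a' 3 3[THEN not_edge_sym] in \<open>auto simp: branch_def farD dest: edge_sym\<close>)
  qed
qed

section \<open>A root of large degree suffices\<close>

text \<open>
  In each case the hub lemmas bound the sizes of the sets \<open>nb2\<close>, \<open>nb3\<close>, \<open>nb4\<close> one after the other, and these
  bounds \<open>h2\<close>, \<open>h3\<close>, \<open>h4\<close> enter the degree condition \<open>28 * (1 + h2 + h3 + h4) + 2\<close> of
  \<open>two_anticomplete_branches\<close>.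
\<close>

lemma embeds_T9:
  assumes "card {y. E x y} \<ge> 87250"
  shows "embeds (T_graph 9)"
proof (rule ccontr)
  assume n: "\<not> embeds (T_graph 9)"
  have 2: "card (nb2 q) \<le> 35" if "far q" for q
    using embeds_T9_of_hub2[OF that] assms n by fastforce
  have 3: "card (nb3 q) \<le> 280" if "far q" for q
    using embeds_T9_of_hub3[OF that 2] assms n by fastforce
  have 4: "card (nb4 q) \<le> 2800" if "far q" for q
    using embeds_T9_of_hub4[OF that 2 3] assms n by fastforce
  show False
    using embeds_T9_of_light[OF 2 3 4] assms n by simp
qed

lemma embeds_T8_2:
  assumes "card {y. E x y} \<ge> 109258"
  shows "embeds T8_2"
proof (rule ccontr)
  assume n: "\<not> embeds T8_2"
  have 2: "card (nb2 q) \<le> 39" if "far q" for q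
    using embeds_T8_2_of_hub2[OF that] assms n by fastforce
  have 3: "card (nb3 q) \<le> 1911" if "far q" for q
    using embeds_T8_2_of_hub3[OF that 2] assms n by fastforce
  have 4: "card (nb4 q) \<le> 1951" if "far q" for q
    using embeds_T8_2_of_hub4[OF that 2 3] assms n by fastforce
  show False
    using embeds_T8_2_of_light[OF 2 3 4] assms n by simp
qed

lemma embeds_T8_1:
  assumes "card {y. E x y} \<ge> 251862"
  shows "embeds T8_1"
proof (rule ccontr)
  assume n: "\<not> embeds T8_1"
  have 2: "card (nb2 q) \<le> 17" if "far q" for q
    using embeds_T8_1_of_hub2[OF that] assms n by fastforce
  have 3: "card (nb3 q) \<le> 374" if "far q" for q
    using embeds_T8_1_of_hub3[OF that 2] assms n by fastforce
  have 4: "card (nb4 q) \<le> 8603" if "far q" for q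
    using embeds_T8_1_of_hub4[OF that 2 3] assms n by fastforce
  show False
    using embeds_T8_1_of_light[OF 2 3 4] assms n by simp
qed

end

section \<open>Transfer to digraphs\<close>

lemma (in graph) induced_inI:
  fixes H :: "'c pair_pre_digraph"
  assumes H: "pair_graph H" and inj: "inj_on f (pverts H)" and sub: "f ` pverts H \<subseteq> verts G"
    and adj: "\<And>a b. a \<in> pverts H \<Longrightarrow> b \<in> pverts H \<Longrightarrow> (f a, f b) \<in> arcs_ends G \<longleftrightarrow> (a, b) \<in> parcs H"
  shows "induced_in H G"
proof -
  interpret H: pair_graph H by fact
  define g where "g e = (THE a. a \<in> arcs G \<and> tail G a = f (fst e) \<and> head G a = f (snd e))" for e
  have arc: "\<exists>!a. a \<in> arcs G \<and> tail G a = u \<and> head G a = v" if "(u, v) \<in> arcs_ends G" for u v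
    using that no_multi_arcs by (fastforce simp: arcs_ends_conv arc_to_ends_def)
  have in_H: "fst e \<in> pverts H" "snd e \<in> pverts H" if "e \<in> parcs H" for e
    using that H.arc_fst_in_verts H.arc_snd_in_verts by auto
  have g: "g e \<in> arcs G \<and> tail G (g e) = f (fst e) \<and> head G (g e) = f (snd e)" if "e \<in> parcs H" for e
  proof -
    have "(f (fst e), f (snd e)) \<in> arcs_ends G"
      using adj in_H[OF that] that by simp
    from theI'[OF arc[OF this]] show ?thesis
      unfolding g_def .
  qed
  let ?K = "G \<restriction> (f ` pverts H)"
  define hom where "hom = \<lparr>iso_verts = f, iso_arcs = g, iso_head = head G, iso_tail = tail G\<rparr>"
  have inj_g: "inj_on g (parcs H)"
  proof (rule inj_onI)
    fix e e' assume e: "e \<in> parcs H" "e' \<in> parcs H" "g e = g e'"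
    then have "f (fst e) = f (fst e')" "f (snd e) = f (snd e')"
      using g by metis+
    then show "e = e'"
      using inj in_H e by (meson inj_onD prod_eqI)
  qed
  have "pre_digraph.digraph_isomorphism (with_proj H) hom"
    unfolding pre_digraph.digraph_isomorphism_def hom_def
    using inj inj_g g H.wf_digraph by simp
  moreover have "?K = app_iso hom (with_proj H)"
  proof -
    have "arcs ?K = g ` parcs H"
    proof (intro equalityI subsetI)
      fix a assume a: "a \<in> arcs ?K"
      then obtain u v where uv: "u \<in> pverts H" "v \<in> pverts H" "a \<in> arcs G" "tail G a = f u" "head G a = f v"
        by auto
      have "(tail G a, head G a) \<in> arcs_ends G"
        using uv(3) by (auto simp: arcs_ends_conv)
      then have "(f u, f v) \<in> arcs_ends G"
        using uv by simp
      moreover from this have "(u, v) \<in> parcs H"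
        using adj uv by blast
      ultimately have "a = g (u, v)"
        using arc g[of "(u, v)"] uv by (metis fst_conv snd_conv)
      then show "a \<in> g ` parcs H"
        using \<open>(u, v) \<in> parcs H\<close> by blast
    next
      fix a assume "a \<in> g ` parcs H"
      then show "a \<in> arcs ?K"
        using g in_H by force
    qed
    then show ?thesis
      by (intro pre_digraph.equality) (simp_all add: app_iso_def hom_def del: induce_subgraph_arcs)
  qed
  ultimately have "digraph_iso (with_proj H) ?K"
    unfolding digraph_iso_def by blast
  moreover have "induced_subgraph ?K G"
    using sub by (rule induced_induce)
  ultimately show ?thesis
    unfolding induced_in_def by blast
qed

lemma parcs_cycle_graph:
  "parcs (cycle_graph n) = (\<lambda>i. (i, Suc i mod n)) ` {..<n} \<union> (\<lambda>i. (Suc i mod n, i)) ` {..<n}"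
  by (auto simp: cycle_graph_def add_edges_def)

lemma parcs_cycle_graph_3:
  "parcs (cycle_graph 3) = {(0, 1), (1, 2), (2, 0), (1, 0), (2, 1), (0, 2)}"
proof -
  have "{..<3} = {0, 1, 2::nat}" by auto
  moreover have "Suc 2 mod 3 = 0" by simp
  ultimately show ?thesis
    unfolding parcs_cycle_graph by (auto simp: numeral_2_eq_2)
qed

lemma parcs_cycle_graph_4:
  "parcs (cycle_graph 4) = {(0, 1), (1, 2), (2, 3), (3, 0), (1, 0), (2, 1), (3, 2), (0, 3)}"
proof -
  have "{..<4} = {0, 1, 2, 3::nat}" by auto
  moreover have "Suc 3 mod 4 = 0" "Suc 2 mod 4 = 3" by simp_all
  ultimately show ?thesis
    unfolding parcs_cycle_graph by (auto simp: numeral_2_eq_2[symmetric])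
qed
lemma (in graph) out_degree_eq: "out_degree G v = card {w. (v, w) \<in> arcs_ends G}"
proof -
  have "{w. (v, w) \<in> arcs_ends G} = head G ` out_arcs G v"
    by (auto simp: arcs_ends_conv image_iff)
  moreover have "inj_on (head G) (out_arcs G v)"
    by (rule inj_onI) (auto intro!: no_multi_arcs simp: arc_to_ends_def)
  ultimately show ?thesis
    by (simp add: out_degree_def card_image)
qed

lemma (in graph) girth5_graph_arcs_ends:
  assumes C3: "\<not> induced_in (cycle_graph 3) G" and C4: "\<not> induced_in (cycle_graph 4) G"
    and deg: "min_degree G \<ge> 3"
  shows "girth5_graph (verts G) (\<lambda>a b. (a, b) \<in> arcs_ends G)"
proof
  let ?E = "\<lambda>a b. (a, b) \<in> arcs_ends G"
  show sym: "?E b a" if "?E a b" for a b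
    using that sym_arcs by (auto simp: symmetric_def sym_def)
  show irr: "\<not> ?E a a" for a
    using no_loops by (auto simp: arcs_ends_conv)
  show in_V: "a \<in> verts G" if "?E a b" for a b
    using that by (auto simp: arcs_ends_conv)
  show tri: "\<not> ?E a c" if "?E a b" "?E b c" for a b c
  proof
    assume "?E a c"
    note E = that this that[THEN sym] this[THEN sym]
    have l: "{..<3} = {0, 1, 2::nat}" by auto
    then have pv: "pverts (cycle_graph 3) = {0, 1, 2}" 
      by (simp add: cycle_graph_def add_edges_def)
    have V: "a \<in> verts G" "b \<in> verts G" "c \<in> verts G"
      using E in_V by blast+
    have ne: "a \<noteq> b" "b \<noteq> c" "a \<noteq> c"
      using E irr by auto
    have "induced_in (cycle_graph 3) G"
      by (rule induced_inI[where f = "\<lambda>i. [a, b, c] ! i", OF pair_graph_cycle_graph])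
        (use E ne V in \<open>auto simp: pv irr parcs_cycle_graph_3 inj_on_def\<close>)
    with C3 show False ..
  qed
  show "a = c \<or> b = d" if "?E a b" "?E b c" "?E c d" "?E d a" for a b c d
  proof (rule ccontr)
    assume n: "\<not> (a = c \<or> b = d)"
    note E = that that[THEN sym]
    have l: "{..<4} = {0, 1, 2, 3::nat}" by auto
    then have pv: "pverts (cycle_graph 4) = {0, 1, 2, 3}" 
      by (simp add: cycle_graph_def add_edges_def)
    have V: "a \<in> verts G" "b \<in> verts G" "c \<in> verts G" "d \<in> verts G"
      using E in_V by blast+
    have ne: "a \<noteq> b" "b \<noteq> c" "c \<noteq> d" "d \<noteq> a" "a \<noteq> d"
      using E irr by auto
    have nE: "\<not> ?E a c" "\<not> ?E b d" "\<not> ?E c a" "\<not> ?E d b"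
      using tri E by blast+
    have "induced_in (cycle_graph 4) G"
    proof (rule induced_inI[where f = "\<lambda>i. [a, b, c, d] ! i", OF pair_graph_cycle_graph])
      show "inj_on (\<lambda>i. [a, b, c, d] ! i) (pverts (cycle_graph 4))"
        unfolding pv using ne n by (auto simp: inj_on_def)
      show "(\<lambda>i. [a, b, c, d] ! i) ` pverts (cycle_graph 4) \<subseteq> verts G"
        unfolding pv using V by simp
      fix i j assume "i \<in> pverts (cycle_graph 4)" "j \<in> pverts (cycle_graph 4)"
      then show "?E ([a, b, c, d] ! i) ([a, b, c, d] ! j) \<longleftrightarrow> (i, j) \<in> parcs (cycle_graph 4)"
        unfolding pv by (elim insertE emptyE) (simp_all add: parcs_cycle_graph_4 E nE irr)
    qed simp
    with C4 show False ..
  qed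
  show "3 \<le> card {b. ?E a b}" if "a \<in> verts G" for a
  proof -
    have "min_degree G \<le> out_degree G a"
      using that by (simp add: min_degree_def)
    then show ?thesis
      using deg by (simp add: out_degree_eq)
  qed
qed simp


theorem theorem1p4:
  fixes G :: "('a, 'b) pre_digraph"
  assumes "graph G"
    and "Digraph_Component.connected G"
    and "\<not> induced_in (cycle_graph 3) G"
    and "\<not> induced_in (cycle_graph 4) G"
    and "min_degree G \<ge> 3"
  shows "(max_degree G \<ge> 943218 \<longrightarrow> induced_in T8_1 G)
    \<and> (max_degree G \<ge> 190375 \<longrightarrow> induced_in T8_2 G)
    \<and> (max_degree G \<ge> 197433 \<longrightarrow> induced_in (T_graph 9) G)"
proof -
  interpret graph G by fact
  let ?E = "\<lambda>a b. (a, b) \<in> arcs_ends G"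
  have "girth5_graph (verts G) ?E"
    using assms by (intro girth5_graph_arcs_ends)
  then interpret g: girth5_graph "verts G" ?E .
  have "verts G \<noteq> {}"
    using assms(2) by (auto simp: connected_def strongly_connected_def)
  then have "max_degree G \<in> out_degree G ` verts G"
    unfolding max_degree_def by (intro Max_in) auto
  then obtain x where x: "x \<in> verts G" "max_degree G = card {y. ?E x y}"
    by (auto simp: out_degree_eq)
  interpret r: rooted_girth5_graph "verts G" ?E x ..
  have transfer: "induced_in H G" if "g.embeds H" "pair_graph H" for H :: "tvert pair_pre_digraph"
  proof -
    obtain f where "inj_on f (pverts H)" "f ` pverts H \<subseteq> verts G"
        "\<And>a b. a \<in> pverts H \<Longrightarrow> b \<in> pverts H \<Longrightarrow> ?E (f a) (f b) \<longleftrightarrow> (a, b) \<in> parcs H"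
      using \<open>g.embeds H\<close> unfolding g.embeds_def by blast
    then show ?thesis
      by (rule induced_inI[OF \<open>pair_graph H\<close>])
  qed
  show ?thesis
    using transfer[OF r.embeds_T8_1 pair_graph_T8_1] transfer[OF r.embeds_T8_2 pair_graph_T8_2]
      transfer[OF r.embeds_T9 pair_graph_T_graph] x(2) by auto
qed

end
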